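(* Let $\mathsf P$ be a network coding problem and $q$ a prime power. A rate-capacity tuple $(\lambda,\omega)$ is $0$-achievable subject to the $q$-linearity constraint if and only if \[(\lambda,\omega)\in\mathsf{CL}\big(\mathrm{proj}_{\mathsf P}[\bar\Upsilon^*_q(\mathsf P)\cap\mathcal C_I(\mathsf P)\cap\mathcal C_T(\mathsf P)\cap\mathcal C_D(\mathsf P)]\big).\] (The sources need not be colocated.)
   Context: A network is $\mathsf G=(\mathcal V,\mathcal E)$, $\mathcal V$ a finite set of nodes, $\mathcal E$ a finite set of hyperedges, each $e$ with tail $\mathrm{tail}(e)\in\mathcal V$ and head $\mathrm{head}(e)\subseteq\mathcal V$, without directed cycles (no nonempty sequence of links $f_1,\dots,f_k$ with $\mathrm{tail}(f_i)\in\mathrm{head}(f_{i-1})$ for $i\ge2$ and $\mathrm{tail}(f_1)\in\mathrm{head}(f_k)$). A connection constraint $\mathsf M=(\mathcal S,O,D)$: finite source index set $\mathcal S$, $O:\mathcal S\to2^{\mathcal V}$ (where source $s$ is available), $D:\mathcal S\to2^{\mathcal V}$ (sinks of $s$). $\mathsf P=(\mathsf G,\mathsf M)$. Sources are imaginary edges with $\mathrm{head}(s)=O(s)$; $\mathrm{in}(e)=\{f\in\mathcal S\cup\mathcal E:\mathrm{tail}(e)\in\mathrm{head}(f)\}$, $\mathrm{in}(u)=\{f\in\mathcal S\cup\mathcal E:u\in\mathrm{head}(f)\}$. A $q$-linear network code for $\mathsf P$ is a family of random variables $\{Y_f:f\in\mathcal S\cup\mathcal E\}$ where each $Y_s$ is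 a row vector over $GF(q)$ of some length whose entries are independent and uniform over $GF(q)$, the $Y_s$ are mutually independent, and each $Y_e$ is a row vector over $GF(q)$ that is a $GF(q)$-linear function of $(Y_f:f\in\mathrm{in}(e))$. $\mathrm{SP}(X)$ is the support of $X$. A rate-capacity tuple is $(\lambda,\omega)$, $\lambda:\mathcal S\to\mathbb R_{\ge0}$, $\omega:\mathcal E\to\mathbb R_{\ge0}$; it is $0$-achievable subject to the $q$-linearity constraint if there exist $q$-linear network codes $\{Y^n_f\}$ ($n=1,2,\dots$) and $c_n>0$ with $\lim_nc_n\log|\mathrm{SP}(Y^n_s)|\ge\lambda(s)$ for all $s$, $\lim_nc_n\log|\mathrm{SP}(Y^n_e)|\le\omega(e)$ for all $e$, and $H(Y^n_s\mid Y^n_f,f\in\mathrm{in}(u))=0$ for all $n$, $s$, $u\in D(s)$. For a finite set $\mathcal N$, $\mathcal H[\mathcal N]$ is the set of real functions on subsets of $\mathcal N$; $g(\alpha\mid\beta)=g(\alpha\cup\beta)-g(\beta)$. A function $h\in\mathcal H[\mathcal N]$ is $q$-representable if there are subspaces $\mathbb U_i$ ($i\in\mathcal N$) of a finite-dimensional vector space over $GF(q)$ with $h(\alpha)=\dim\langle\mathbb U_i:i\in\alpha\rangle$ (dimension of their span) for all $\alpha$; weakly $q$-representable if $ch$ is $q$-representable for some $c>0$; almost $q$-representable if it is a limit of weakly $q$-representable functions. $\bar\Upsilon^*_q(\mathsf P)$ is the set of almost $q$-representable functions in $\mathcal H[\mathcal S\cup\mathcal E]$. $\mathcal C_I(\mathsf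 P)=\{h:h(\mathcal S)=\sum_sh(s)\}$, $\mathcal C_T(\mathsf P)=\{h:h(e\mid\mathrm{in}(e))=0\ \forall e\in\mathcal E\}$, $\mathcal C_D(\mathsf P)=\{h:h(s\mid\mathrm{in}(u))=0\ \forall s\in\mathcal S,u\in D(s)\}$. $\mathrm{proj}_{\mathsf P}[h]=(h(s),s\in\mathcal S;h(e),e\in\mathcal E)$, applied elementwise to sets. For a set $\mathcal R$ of tuples, $\mathsf{CL}(\mathcal R)$ is the set of $(\lambda,\omega)$ such that there exist $(\lambda^n,\omega^n)\in\mathcal R$ and $c_n>0$ with $\lim_nc_n\omega^n(e)\le\omega(e)$ and $\lim_nc_n\lambda^n(s)\ge\lambda(s)$ for all $e,s$. *)

theory Defs
  imports Complex_Main "HOL-Library.Function_Algebras"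
begin

text \<open>The space of all functions nat => k with pointwise operations; a vector of length m
  is a function vanishing at all indices >= m.\<close>

definition fscale :: "'k::field \<Rightarrow> (nat \<Rightarrow> 'k) \<Rightarrow> (nat \<Rightarrow> 'k)" where
  "fscale c f = (\<lambda>i. c * f i)"

interpretation fvs: vector_space "fscale :: 'k::field \<Rightarrow> (nat \<Rightarrow> 'k) \<Rightarrow> (nat \<Rightarrow> 'k)"
  by unfold_locales (auto simp: fscale_def fun_eq_iff algebra_simps)

definition vecs :: "nat \<Rightarrow> (nat \<Rightarrow> 'k::zero) set" where
  "vecs m = {f. \<forall>j\<ge>m. f j = 0}"

text \<open>Links are sources (Inl s) or hyperedges (Inr e). Sources are imaginary edges with
  head(s) = Og(s).\<close>

definition link_head :: "('e \<Rightarrow> 'v set) \<Rightarrow> ('s \<Rightarrow> 'v set) \<Rightarrow> ('s + 'e) \<Rightarrow> 'v set" where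
  "link_head head Og f = (case f of Inl s \<Rightarrow> Og s | Inr e \<Rightarrow> head e)"

definition links :: "'s set \<Rightarrow> 'e set \<Rightarrow> ('s + 'e) set" where
  "links S E = Inl ` S \<union> Inr ` E"

definition in_edge :: "'s set \<Rightarrow> 'e set \<Rightarrow> ('e \<Rightarrow> 'v) \<Rightarrow> ('e \<Rightarrow> 'v set) \<Rightarrow> ('s \<Rightarrow> 'v set)
    \<Rightarrow> 'e \<Rightarrow> ('s + 'e) set" where
  "in_edge S E tail head Og e = {f \<in> links S E. tail e \<in> link_head head Og f}"

definition in_node :: "'s set \<Rightarrow> 'e set \<Rightarrow> ('e \<Rightarrow> 'v set) \<Rightarrow> ('s \<Rightarrow> 'v set)
    \<Rightarrow> 'v \<Rightarrow> ('s + 'e) set" where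
  "in_node S E head Og u = {f \<in> links S E. u \<in> link_head head Og f}"

definition acyclic_net :: "'e set \<Rightarrow> ('e \<Rightarrow> 'v) \<Rightarrow> ('e \<Rightarrow> 'v set) \<Rightarrow> bool" where
  "acyclic_net E tail head \<longleftrightarrow>
     \<not> (\<exists>fs. fs \<noteq> [] \<and> set fs \<subseteq> E \<and>
           (\<forall>i. Suc i < length fs \<longrightarrow> tail (fs ! Suc i) \<in> head (fs ! i)) \<and>
           tail (hd fs) \<in> head (last fs))"

definition network_problem ::
  "'v set \<Rightarrow> 'e set \<Rightarrow> ('e \<Rightarrow> 'v) \<Rightarrow> ('e \<Rightarrow> 'v set) \<Rightarrow>
   's set \<Rightarrow> ('s \<Rightarrow> 'v set) \<Rightarrow> ('s \<Rightarrow> 'v set) \<Rightarrow> bool" where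
  "network_problem V E tail head S Og D \<longleftrightarrow>
     finite V \<and> finite E \<and> finite S \<and>
     (\<forall>e\<in>E. tail e \<in> V \<and> head e \<subseteq> V) \<and>
     (\<forall>s\<in>S. Og s \<subseteq> V \<and> D s \<subseteq> V) \<and>
     acyclic_net E tail head"

text \<open>A q-linear code is given by lengths d f of the row vectors Y_f and, for each link f,
  the value Y f x of Y_f as a function of the outcome x of the sources.  The sample space
  is the (finite) set of all source outcomes, x s being a row vector of length d (Inl s);
  equipped with the uniform distribution this makes the Y_s mutually independent with
  independent uniform entries.  Y_e (e in E) is a GF(q)-linear function of the Y_f,
  f in in(e), of length d (Inr e).\<close>

definition sample_space :: "'s set \<Rightarrow> (('s + 'e) \<Rightarrow> nat) \<Rightarrow> ('s \<Rightarrow> nat \<Rightarrow> 'k::zero) set" where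
  "sample_space S d = {x. \<forall>s. (s \<in> S \<longrightarrow> x s \<in> vecs (d (Inl s))) \<and> (s \<notin> S \<longrightarrow> x s = (\<lambda>_. 0))}"

definition linear_code ::
  "'s set \<Rightarrow> 'e set \<Rightarrow> ('e \<Rightarrow> 'v) \<Rightarrow> ('e \<Rightarrow> 'v set) \<Rightarrow> ('s \<Rightarrow> 'v set) \<Rightarrow>
   (('s + 'e) \<Rightarrow> nat) \<Rightarrow> (('s + 'e) \<Rightarrow> ('s \<Rightarrow> nat \<Rightarrow> 'k::field) \<Rightarrow> (nat \<Rightarrow> 'k)) \<Rightarrow> bool" where
  "linear_code S E tail head Og d Y \<longleftrightarrow>
     (\<forall>s\<in>S. \<forall>x\<in>sample_space S d. Y (Inl s) x = x s) \<and>
     (\<forall>e\<in>E. \<exists>c :: ('s + 'e) \<Rightarrow> nat \<Rightarrow> nat \<Rightarrow> 'k.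
        \<forall>x\<in>sample_space S d. Y (Inr e) x =
          (\<lambda>j. if j < d (Inr e)
               then (\<Sum>f\<in>in_edge S E tail head Og e. \<Sum>i<d f. c f i j * Y f x i)
               else 0))"

definition supp_size :: "'s set \<Rightarrow> (('s + 'e) \<Rightarrow> nat) \<Rightarrow>
   (('s + 'e) \<Rightarrow> ('s \<Rightarrow> nat \<Rightarrow> 'k::field) \<Rightarrow> (nat \<Rightarrow> 'k)) \<Rightarrow> ('s + 'e) \<Rightarrow> nat" where
  "supp_size S d Y f = card (Y f ` sample_space S d)"

text \<open>H(Y_s | Y_f, f in A) = 0: for finite random variables under the uniform (full-support)
  distribution on the sample space, this says Y_s is a function of (Y_f)_{f in A}.\<close>

definition cond_entropy_zero :: "'s set \<Rightarrow> (('s + 'e) \<Rightarrow> nat) \<Rightarrow>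
   (('s + 'e) \<Rightarrow> ('s \<Rightarrow> nat \<Rightarrow> 'k::field) \<Rightarrow> (nat \<Rightarrow> 'k)) \<Rightarrow> ('s + 'e) \<Rightarrow> ('s + 'e) set \<Rightarrow> bool" where
  "cond_entropy_zero S d Y g A \<longleftrightarrow>
     (\<forall>x\<in>sample_space S d. \<forall>x'\<in>sample_space S d.
        (\<forall>f\<in>A. Y f x = Y f x') \<longrightarrow> Y g x = Y g x')"

definition zero_achievable_lin ::
  "'k::{finite,field} itself \<Rightarrow> 'e set \<Rightarrow> ('e \<Rightarrow> 'v) \<Rightarrow> ('e \<Rightarrow> 'v set) \<Rightarrow>
   's set \<Rightarrow> ('s \<Rightarrow> 'v set) \<Rightarrow> ('s \<Rightarrow> 'v set) \<Rightarrow> ('s \<Rightarrow> real) \<Rightarrow> ('e \<Rightarrow> real) \<Rightarrow> bool" where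
  "zero_achievable_lin TYPE('k) E tail head S Og D lam om \<longleftrightarrow>
     (\<exists>(d :: nat \<Rightarrow> ('s + 'e) \<Rightarrow> nat)
        (Y :: nat \<Rightarrow> ('s + 'e) \<Rightarrow> ('s \<Rightarrow> nat \<Rightarrow> 'k) \<Rightarrow> (nat \<Rightarrow> 'k))
        (c :: nat \<Rightarrow> real).
       (\<forall>n. linear_code S E tail head Og (d n) (Y n)) \<and>
       (\<forall>n. c n > 0) \<and>
       (\<forall>s\<in>S. \<exists>L. (\<lambda>n. c n * ln (real (supp_size S (d n) (Y n) (Inl s)))) \<longlonglongrightarrow> L
                   \<and> L \<ge> lam s) \<and>
       (\<forall>e\<in>E. \<exists>L. (\<lambda>n. c n * ln (real (supp_size S (d n) (Y n) (Inr e)))) \<longlonglongrightarrow> L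
                   \<and> L \<le> om e) \<and>
       (\<forall>n. \<forall>s\<in>S. \<forall>u\<in>D s. cond_entropy_zero S (d n) (Y n) (Inl s) (in_node S E head Og u)))"

text \<open>h in H[N] is q-representable if there are subspaces U_i (i in N) of a finite-dimensional
  vector space over GF(q) (here: the space vecs m of row vectors of length m, m arbitrary)
  with h(alpha) = dim of the span of the U_i, i in alpha, for all alpha subset of N.\<close>

definition q_representable :: "'k::{finite,field} itself \<Rightarrow> 'i set \<Rightarrow> ('i set \<Rightarrow> real) \<Rightarrow> bool" where
  "q_representable TYPE('k) N h \<longleftrightarrow>
     (\<exists>m (U :: 'i \<Rightarrow> (nat \<Rightarrow> 'k) set).
        (\<forall>i\<in>N. fvs.subspace (U i) \<and> U i \<subseteq> vecs m) \<and>
        (\<forall>\<alpha>\<subseteq>N. h \<alpha> = real (fvs.dim (\<Union>i\<in>\<alpha>. U i))))"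

definition weakly_q_representable :: "'k::{finite,field} itself \<Rightarrow> 'i set \<Rightarrow> ('i set \<Rightarrow> real) \<Rightarrow> bool" where
  "weakly_q_representable TYPE('k) N h \<longleftrightarrow>
     (\<exists>c>0. q_representable TYPE('k) N (\<lambda>\<alpha>. c * h \<alpha>))"

definition almost_q_representable :: "'k::{finite,field} itself \<Rightarrow> 'i set \<Rightarrow> ('i set \<Rightarrow> real) \<Rightarrow> bool" where
  "almost_q_representable TYPE('k) N h \<longleftrightarrow>
     (\<exists>g :: nat \<Rightarrow> 'i set \<Rightarrow> real.
        (\<forall>n. weakly_q_representable TYPE('k) N (g n)) \<and>
        (\<forall>\<alpha>\<subseteq>N. (\<lambda>n. g n \<alpha>) \<longlonglongrightarrow> h \<alpha>))"

definition Upsilon_bar :: "'k::{finite,field} itself \<Rightarrow> 's set \<Rightarrow> 'e set \<Rightarrow> (('s + 'e) set \<Rightarrow> real) set" where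
  "Upsilon_bar TYPE('k) S E = {h. almost_q_representable TYPE('k) (links S E) h}"

definition C_I :: "'s set \<Rightarrow> (('s + 'e) set \<Rightarrow> real) set" where
  "C_I S = {h. h (Inl ` S) = (\<Sum>s\<in>S. h {Inl s})}"

definition C_T :: "'s set \<Rightarrow> 'e set \<Rightarrow> ('e \<Rightarrow> 'v) \<Rightarrow> ('e \<Rightarrow> 'v set) \<Rightarrow> ('s \<Rightarrow> 'v set)
    \<Rightarrow> (('s + 'e) set \<Rightarrow> real) set" where
  "C_T S E tail head Og = {h. \<forall>e\<in>E.
      h ({Inr e} \<union> in_edge S E tail head Og e) - h (in_edge S E tail head Og e) = 0}"

definition C_D :: "'s set \<Rightarrow> 'e set \<Rightarrow> ('e \<Rightarrow> 'v set) \<Rightarrow> ('s \<Rightarrow> 'v set) \<Rightarrow> ('s \<Rightarrow> 'v set)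
    \<Rightarrow> (('s + 'e) set \<Rightarrow> real) set" where
  "C_D S E head Og D = {h. \<forall>s\<in>S. \<forall>u\<in>D s.
      h ({Inl s} \<union> in_node S E head Og u) - h (in_node S E head Og u) = 0}"

definition proj :: "(('s + 'e) set \<Rightarrow> real) \<Rightarrow> ('s \<Rightarrow> real) \<times> ('e \<Rightarrow> real)" where
  "proj h = ((\<lambda>s. h {Inl s}), (\<lambda>e. h {Inr e}))"

definition CL :: "'s set \<Rightarrow> 'e set \<Rightarrow> (('s \<Rightarrow> real) \<times> ('e \<Rightarrow> real)) set
    \<Rightarrow> (('s \<Rightarrow> real) \<times> ('e \<Rightarrow> real)) set" where
  "CL S E R = {(lam, om). \<exists>(t :: nat \<Rightarrow> ('s \<Rightarrow> real) \<times> ('e \<Rightarrow> real)) (c :: nat \<Rightarrow> real).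
      (\<forall>n. t n \<in> R) \<and> (\<forall>n. c n > 0) \<and>
      (\<forall>e\<in>E. \<exists>L. (\<lambda>n. c n * snd (t n) e) \<longlonglongrightarrow> L \<and> L \<le> om e) \<and>
      (\<forall>s\<in>S. \<exists>L. (\<lambda>n. c n * fst (t n) s) \<longlonglongrightarrow> L \<and> L \<ge> lam s)}"

end

theory Submission
  imports Defs "HOL-Library.Disjoint_Sets" "HOL-Library.FuncSet" "HOL-Library.Cardinality"
begin

text \<open>
  A linear code is a family of subspaces of linear functionals on the space of source outcomes:
  acyclicity makes every \<open>Y\<^sub>f\<close> linear in the outcome, and the dimension function of these subspaces is
  representable, satisfies all constraints exactly, and gives the logarithms of the support sizes
  to base \<open>q\<close>.

  Conversely, an almost representable function satisfying the constraints is approximated by scaled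
  dimension functions of subspaces \<open>U\<^sub>f\<close> that violate them only by \<open>o(1)\<close>. Working modulo a small
  subspace \<open>K\<close> repairs all violations: first put into \<open>K\<close>, for each edge \<open>e\<close> with \<open>W\<close> the span of the
  \<open>U\<^sub>f\<close> entering \<open>e\<close>, a complement of \<open>W\<close> in \<open>U\<^sub>e + W\<close>, and likewise for the sinks, then all intersections of a source space
  \<open>U\<^sub>s\<close> with the span of \<open>K\<close> and the other source spaces. The dimension of \<open>K\<close> is linear in the total
  violation. The source spaces are now independent modulo \<open>K\<close>, so every source outcome \<open>x\<close> is realised
  by a linear functional \<open>\<phi> x\<close> that vanishes on \<open>K\<close>; evaluating \<open>\<phi> x\<close> on bases of the \<open>U\<^sub>f\<close> is the code.
\<close>

section \<open>Linear algebra\<close>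

context vector_space
begin

text \<open>Finiteness carries the claim: \<open>dim\<close> is 0 for a set whose span has no finite
  basis, so monotonicity can fail for infinite \<open>W\<close>. The subspaces used later are finite
  sets, being contained in \<open>vecs m\<close> over a finite field.\<close>

lemma dim_mono_finite:
  assumes "V \<subseteq> span W" "finite W"
  shows "dim V \<le> dim W"
proof -
  obtain B where B: "B \<subseteq> W" "independent B" "W \<subseteq> span B" "card B = dim W"
    by (rule basis_exists)
  have "V \<subseteq> span B"
    using assms(1) span_minimal[OF B(3) subspace_span] by blast
  with B assms(2) show ?thesis
    using dim_le_card[of V B] finite_subset by fastforce
qed

lemma independent_card_le_dim_finite:
  assumes "B \<subseteq> V" "independent B" "finite V"
  shows "card B \<le> dim V"
  by (metis assms dim_eq_card_independent dim_mono_finite span_superset subset_trans)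

text \<open>Extend a basis of \<open>A\<close> to one of \<open>A \<union> C\<close>;
  \<open>F\<close> consists of the new vectors. This converts a conditional dimension, the amount by
  which a constraint is violated, into exactly that many vectors whose adjunction removes the
  violation.\<close>

lemma exists_relative_basis:
  assumes "finite A" "finite C"
  obtains F where "F \<subseteq> C" "C \<subseteq> span (A \<union> F)" "card F + dim A = dim (A \<union> C)"
proof -
  obtain B where B: "B \<subseteq> A" "independent B" "A \<subseteq> span B" "card B = dim A"
    by (rule basis_exists)
  obtain B' where B': "B \<subseteq> B'" "B' \<subseteq> B \<union> C" "independent B'" "B \<union> C \<subseteq> span B'"
    using maximal_independent_subset_extend[of B "B \<union> C"] B(2) by blast
  have fin: "finite B'"
    using finite_subset[OF B(1) assms(1)] finite_subset[OF B'(2)] assms(2) by simp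
  have "A \<subseteq> span B'"
    using B(3) B'(1) span_mono by blast
  then have "card B' = dim (A \<union> C)"
    using B(1) B' by (intro basis_card_eq_dim) auto
  moreover have "card (B' - B) + card B = card B'"
    using fin B'(1) by (simp add: card_Diff_subset card_mono finite_subset)
  moreover have "span B' \<subseteq> span (A \<union> (B' - B))"
    using B(1) by (intro span_mono) auto
  moreover have "C \<subseteq> span B'" "B' - B \<subseteq> C" using B'(2,4) by auto
  ultimately show ?thesis
    using that[of "B' - B"] B(4) by fastforce
qed

text \<open>One half of the dimension formula for a sum and an intersection. A basis
  \<open>G\<close> of \<open>U \<inter> span A\<close> extends to a basis \<open>H\<close> of
  \<open>U\<close>, and a basis of \<open>A\<close> together with \<open>H - G\<close> already spans
  \<open>A \<union> U\<close>.\<close>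

lemma exists_basis_Int_span:
  assumes "subspace U" "finite U" "finite A"
  obtains G where "G \<subseteq> U" "U \<inter> span A \<subseteq> span G"
    "dim (A \<union> U) + card G \<le> dim A + dim U"
proof -
  obtain G where G: "G \<subseteq> U \<inter> span A" "independent G" "U \<inter> span A \<subseteq> span G"
    by (rule maximal_independent_subset)
  obtain H where H: "G \<subseteq> H" "H \<subseteq> U" "independent H" "U \<subseteq> span H"
    using maximal_independent_subset_extend[of G U] G by blast
  have fin: "finite H"
    by (rule finite_subset[OF H(2) assms(2)])
  then have finG: "finite G"
    by (rule finite_subset[OF H(1)])
  obtain B where B: "B \<subseteq> A" "independent B" "A \<subseteq> span B" "card B = dim A"
    by (rule basis_exists)
  let ?T = "B \<union> (H - G)"
  have spanA: "span A \<subseteq> span ?T"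
    using span_minimal[OF B(3) subspace_span] span_mono[of B ?T] by blast
  have "H \<subseteq> span ?T"
    using spanA G(1) span_superset[of ?T] by blast
  then have "U \<subseteq> span ?T"
    using H(4) span_minimal[OF _ subspace_span, of H ?T] by blast
  then have "A \<union> U \<subseteq> span ?T"
    using spanA span_superset[of A] by blast
  then have "dim (A \<union> U) \<le> card ?T"
    using finite_subset[OF B(1) assms(3)] fin by (intro dim_le_card) auto
  also have "\<dots> \<le> card B + card (H - G)"
    by (rule card_Un_le)
  also have "card (H - G) = card H - card G"
    using H(1) finG by (simp add: card_Diff_subset)
  also have "card H = dim U"
    using H by (intro basis_card_eq_dim) auto
  finally have "dim (A \<union> U) \<le> dim A + (dim U - card G)"
    using B(4) by simp
  moreover have "card G \<le> dim U"
    using G(1,2) assms(2) by (intro independent_card_le_dim_finite) auto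
  ultimately show ?thesis
    using that[of G] G by simp
qed

lemma dim_Un_UN_le:
  assumes "finite F" "finite T" "\<And>t. t \<in> T \<Longrightarrow> finite (U t)"
  shows "dim (F \<union> (\<Union>t\<in>T. U t)) \<le> card F + (\<Sum>t\<in>T. dim (U t))"
proof -
  have "\<forall>t\<in>T. \<exists>B. B \<subseteq> U t \<and> U t \<subseteq> span B \<and> card B = dim (U t)"
  proof
    fix t assume "t \<in> T"
    obtain B where "B \<subseteq> U t" "independent B" "U t \<subseteq> span B" "card B = dim (U t)"
      by (rule basis_exists)
    then show "\<exists>B. B \<subseteq> U t \<and> U t \<subseteq> span B \<and> card B = dim (U t)" by blast
  qed
  then obtain B where B: "\<And>t. t \<in> T \<Longrightarrow> B t \<subseteq> U t \<and> U t \<subseteq> span (B t) \<and> card (B t) = dim (U t)"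
    by metis
  let ?B = "F \<union> (\<Union>t\<in>T. B t)"
  have "F \<union> (\<Union>t\<in>T. U t) \<subseteq> span ?B"
  proof -
    have "U t \<subseteq> span ?B" if "t \<in> T" for t
      using B[OF that] span_mono[of "B t" ?B] that by blast
    then show ?thesis
      using span_superset[of ?B] by blast
  qed
  moreover have "finite ?B"
    using assms B finite_subset[of "B t" "U t" for t] by auto
  ultimately have "dim (F \<union> (\<Union>t\<in>T. U t)) \<le> card ?B"
    by (rule dim_le_card)
  also have "\<dots> \<le> card F + card (\<Union>t\<in>T. B t)"
    by (rule card_Un_le)
  also have "card (\<Union>t\<in>T. B t) \<le> (\<Sum>t\<in>T. card (B t))"
    by (rule card_UN_le[OF assms(2)])
  also have "\<dots> = (\<Sum>t\<in>T. dim (U t))"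
    using B by simp
  finally show ?thesis by simp
qed

section \<open>Independence of subspaces modulo a small set\<close>

text \<open>For each \<open>s\<close> a basis \<open>G s\<close> of the intersection of
  \<open>U s\<close> with the span of \<open>F\<close> and the other subspaces is added to
  \<open>F\<close>. One round is enough: every added \<open>G t\<close> with
  \<open>t \<noteq> s\<close> lies inside \<open>U t\<close>, so it creates no new intersection with
  \<open>U s\<close>.\<close>

lemma exists_independence_modulo:
  assumes S: "finite S" and F: "finite F"
    and U: "\<And>s. s \<in> S \<Longrightarrow> subspace (U s) \<and> finite (U s)"
    and gap: "(\<Sum>s\<in>S. dim (U s)) \<le> dim (\<Union>s\<in>S. U s) + g"
  obtains K where "finite K" "F \<subseteq> K" "card K \<le> card F + card S * (card F + g)"
    "\<And>s. s \<in> S \<Longrightarrow> U s \<inter> span (K \<union> (\<Union>t\<in>S-{s}. U t)) \<subseteq> span K"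
proof -
  define A where "A s = F \<union> (\<Union>t\<in>S-{s}. U t)" for s
  have finA: "finite (A s)" for s
    using S F U by (auto simp: A_def)
  have "\<exists>G. G \<subseteq> U s \<and> U s \<inter> span (A s) \<subseteq> span G \<and>
      dim (A s \<union> U s) + card G \<le> dim (A s) + dim (U s)" if "s \<in> S" for s
    using exists_basis_Int_span[of "U s" "A s"] U[OF that] finA by metis
  then obtain G where G: "\<And>s. s \<in> S \<Longrightarrow> G s \<subseteq> U s \<and> U s \<inter> span (A s) \<subseteq> span (G s) \<and>
      dim (A s \<union> U s) + card (G s) \<le> dim (A s) + dim (U s)"
    by metis
  \<comment> \<open>In the inequality for \<open>G s\<close>, \<open>A s \<union> U s\<close> has
    dimension at least that of the joint span of all the subspaces, which is the full sum up to
    \<open>g\<close>; \<open>A s\<close> has at most \<open>card F\<close> plus the sum over the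
    other subspaces.\<close>
  have cardG: "card (G s) \<le> card F + g" if s: "s \<in> S" for s
  proof -
    have "dim (\<Union>s\<in>S. U s) \<le> dim (A s \<union> U s)"
    proof (rule dim_mono_finite)
      have "(\<Union>s\<in>S. U s) \<subseteq> A s \<union> U s" by (auto simp: A_def)
      then show "(\<Union>s\<in>S. U s) \<subseteq> span (A s \<union> U s)"
        using span_superset by blast
      show "finite (A s \<union> U s)" using finA U[OF s] by simp
    qed
    moreover have "dim (A s) \<le> card F + (\<Sum>t\<in>S-{s}. dim (U t))"
      unfolding A_def using S F U by (intro dim_Un_UN_le) auto
    moreover have "(\<Sum>t\<in>S. dim (U t)) = dim (U s) + (\<Sum>t\<in>S-{s}. dim (U t))"
      using S s by (rule sum.remove)
    ultimately show ?thesis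
      using G[OF s] gap by linarith
  qed
  define K where "K = F \<union> (\<Union>s\<in>S. G s)"
  have "finite K"
    unfolding K_def using S F U G finite_subset[of "G s" "U s" for s] by auto
  moreover have "F \<subseteq> K" by (simp add: K_def)
  moreover have "card K \<le> card F + card S * (card F + g)"
  proof -
    have "card K \<le> card F + card (\<Union>s\<in>S. G s)"
      unfolding K_def by (rule card_Un_le)
    also have "card (\<Union>s\<in>S. G s) \<le> (\<Sum>s\<in>S. card (G s))"
      by (rule card_UN_le[OF S])
    also have "\<dots> \<le> card S * (card F + g)"
      using sum_bounded_above[of S "\<lambda>s. card (G s)" "card F + g"] cardG by simp
    finally show ?thesis by simp
  qed
  moreover have "U s \<inter> span (K \<union> (\<Union>t\<in>S-{s}. U t)) \<subseteq> span K" if s: "s \<in> S" for s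
  proof
    fix u assume u: "u \<in> U s \<inter> span (K \<union> (\<Union>t\<in>S-{s}. U t))"
    have "K \<union> (\<Union>t\<in>S-{s}. U t) \<subseteq> G s \<union> A s"
      using G unfolding K_def A_def by blast
    with u have "u \<in> span (G s \<union> A s)"
      using span_mono[of "K \<union> (\<Union>t\<in>S-{s}. U t)" "G s \<union> A s"] by blast
    then obtain z a where za: "u = z + a" "z \<in> span (G s)" "a \<in> span (A s)"
      unfolding span_Un by auto
    \<comment> \<open>Both \<open>u\<close> and \<open>z\<close> lie in \<open>U s\<close>, hence so
      does \<open>a\<close>; being also in \<open>span (A s)\<close>, it is caught by
      \<open>G s\<close>.\<close>
    have "z \<in> U s"
      using za(2) G[OF s] U[OF s] span_minimal[of "G s" "U s"] by blast
    then have "a \<in> U s"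
      using subspace_diff[of "U s" u z] u U[OF s] unfolding za(1) by simp
    then have "a \<in> span (G s)"
      using za(3) G[OF s] by blast
    then have "u \<in> span (G s)"
      using za span_add by blast
    then show "u \<in> span K"
      using span_mono[of "G s" K] s by (auto simp: K_def)
  qed
  ultimately show ?thesis
    by (rule that)
qed

text \<open>Starting from a basis \<open>B0\<close> of \<open>K\<close>, the subspaces are adjoined
  one at a time, each contributing the vectors \<open>B s\<close> needed to extend the independent
  set built so far. The hypothesis \<open>indep\<close> ensures that \<open>U s\<close> meets the
  earlier span only inside \<open>span K\<close>, so \<open>K\<close> and \<open>B s\<close> alone
  span \<open>U s\<close>.\<close>

lemma exists_independent_system:
  assumes "finite S"
    and U: "\<And>s. s \<in> S \<Longrightarrow> subspace (U s)"
    and indep: "\<And>s. s \<in> S \<Longrightarrow> U s \<inter> span (K \<union> (\<Union>t\<in>S-{s}. U t)) \<subseteq> span K"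
  obtains B0 B where "K \<subseteq> span B0" "\<And>s. s \<in> S \<Longrightarrow> B s \<subseteq> U s \<and> U s \<subseteq> span (K \<union> B s) \<and> B s \<inter> B0 = {}"
    "independent (B0 \<union> (\<Union>s\<in>S. B s))" "disjoint_family_on B S"
proof -
  obtain B0 where B0: "B0 \<subseteq> K" "independent B0" "K \<subseteq> span B0"
    using maximal_independent_subset by blast
  have "\<exists>B. (\<forall>s\<in>T. B s \<subseteq> U s \<and> U s \<subseteq> span (K \<union> B s) \<and> B s \<inter> B0 = {}) \<and>
      independent (B0 \<union> (\<Union>s\<in>T. B s)) \<and> disjoint_family_on B T" if "T \<subseteq> S" for T
    using finite_subset[OF that assms(1)] that
  proof (induction T rule: finite_subset_induct')
    case empty
    then show ?case using B0 by (auto simp: disjoint_family_on_def)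
  next
    case (insert s T)
    from insert.IH obtain B where B: "\<forall>t\<in>T. B t \<subseteq> U t \<and> U t \<subseteq> span (K \<union> B t) \<and> B t \<inter> B0 = {}"
      "independent (B0 \<union> (\<Union>s\<in>T. B s))" "disjoint_family_on B T"
      by (elim exE conjE)
    note insert = insert.hyps
    let ?P = "B0 \<union> (\<Union>s\<in>T. B s)"
    obtain Q where Q: "?P \<subseteq> Q" "Q \<subseteq> ?P \<union> U s" "independent Q" "?P \<union> U s \<subseteq> span Q"
      using maximal_independent_subset_extend[of ?P "?P \<union> U s"] B(2) by blast
    let ?C = "Q - ?P"
    have CU: "?C \<subseteq> U s" using Q(2) by auto
    have Qeq: "Q = ?C \<union> ?P" using Q(1) by auto
    have "U s \<subseteq> span (K \<union> ?C)"
    proof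
      fix u assume u: "u \<in> U s"
      then have "u \<in> span (?C \<union> ?P)" using Q(4) Qeq by auto
      then obtain z a where za: "u = z + a" "z \<in> span ?C" "a \<in> span ?P"
        unfolding span_Un[of ?C ?P] by auto
      \<comment> \<open>Split \<open>u\<close> into a new part \<open>z\<close> and an old part
        \<open>a\<close>. Since \<open>z\<close> comes from \<open>U s\<close>, so does
        \<open>a\<close>, and independence modulo \<open>K\<close> places \<open>a\<close> in
        \<open>span K\<close>.\<close>
      have "z \<in> U s"
        using za(2) span_minimal[OF CU] U insert(2) by blast
      then have "a \<in> U s"
        using subspace_diff[OF U[OF insert(2)] u, of z] unfolding za(1) by simp
      moreover have "?P \<subseteq> K \<union> (\<Union>t\<in>S-{s}. U t)"
      proof -
        have "B t \<subseteq> U t" "t \<in> S - {s}" if "t \<in> T" for t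
          using B(1) insert(3,4) that by auto
        with B0(1) show ?thesis by blast
      qed
      then have "a \<in> span (K \<union> (\<Union>t\<in>S-{s}. U t))"
        using za(3) span_mono[of ?P "K \<union> (\<Union>t\<in>S-{s}. U t)"] by blast
      ultimately have "a \<in> span K" using indep[OF insert(2)] by blast
      then show "u \<in> span (K \<union> ?C)"
        using za span_mono[of K "K \<union> ?C"] span_mono[of ?C "K \<union> ?C"]
        by (auto intro!: span_add)
    qed
    moreover have "B0 \<union> (\<Union>t\<in>insert s T. (B(s := ?C)) t) = Q"
      using Qeq insert by auto
    moreover have "disjoint_family_on (B(s := ?C)) (insert s T)"
      using B(3) insert by (auto simp: disjoint_family_on_def)
    moreover have "(B(s := ?C)) t = B t" if "t \<in> T" for t
      using that insert by auto
    moreover have "?C \<inter> B0 = {}" by auto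
    ultimately show ?case
      using CU B(1) Q(3)
      by (intro exI[of _ "B(s := ?C)"] conjI) (simp_all del: UN_insert fun_upd_apply add: fun_upd_same)
  qed
  from this[OF subset_refl] obtain B where
    "\<forall>s\<in>S. B s \<subseteq> U s \<and> U s \<subseteq> span (K \<union> B s) \<and> B s \<inter> B0 = {}"
    "independent (B0 \<union> (\<Union>s\<in>S. B s))" "disjoint_family_on B S"
    by (elim exE conjE)
  with B0(3) show ?thesis
    by (intro that[of B0 B]) simp_all
qed

text \<open>A function on an independent set extends to a linear functional. Prescribing 0 on
  \<open>B0\<close> makes it vanish on \<open>K\<close>, while the values on all the
  \<open>B s\<close> stay free.\<close>

lemma exists_interpolating_system:
  assumes "finite S"
    and "\<And>s. s \<in> S \<Longrightarrow> subspace (U s)"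
    and "\<And>s. s \<in> S \<Longrightarrow> U s \<inter> span (K \<union> (\<Union>t\<in>S-{s}. U t)) \<subseteq> span K"
  obtains B where "\<And>s. s \<in> S \<Longrightarrow> B s \<subseteq> U s \<and> U s \<subseteq> span (K \<union> B s) \<and> independent (B s)"
    "\<And>y. \<exists>\<phi>. Vector_Spaces.linear scale (*) \<phi> \<and> (\<forall>k\<in>K. \<phi> k = 0) \<and> (\<forall>s\<in>S. \<forall>b\<in>B s. \<phi> b = y s b)"
proof -
  interpret pair: vector_space_pair scale "(*)"
    by unfold_locales (auto simp: algebra_simps)
  obtain B0 B where B: "K \<subseteq> span B0"
    "\<And>s. s \<in> S \<Longrightarrow> B s \<subseteq> U s \<and> U s \<subseteq> span (K \<union> B s) \<and> B s \<inter> B0 = {}"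
    "independent (B0 \<union> (\<Union>s\<in>S. B s))" "disjoint_family_on B S"
    by (rule exists_independent_system[of S U K]) (use assms in blast)+
  have "\<exists>\<phi>. Vector_Spaces.linear scale (*) \<phi> \<and> (\<forall>k\<in>K. \<phi> k = 0) \<and> (\<forall>s\<in>S. \<forall>b\<in>B s. \<phi> b = y s b)" for y
  proof -
    \<comment> \<open>Disjointness of the family \<open>B\<close> makes the index under
      \<open>THE\<close> unique, and disjointness from \<open>B0\<close> sends every vector of
      \<open>B s\<close> to the second branch.\<close>
    define w where "w b = (if b \<in> B0 then 0 else y (THE s. s \<in> S \<and> b \<in> B s) b)" for b
    obtain \<phi> where \<phi>: "Vector_Spaces.linear scale (*) \<phi>" "\<forall>b\<in>B0 \<union> (\<Union>s\<in>S. B s). \<phi> b = w b"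
      using pair.linear_independent_extend[OF B(3)] by blast
    have "\<phi> b = y s b" if "s \<in> S" "b \<in> B s" for s b
    proof -
      have "(THE s. s \<in> S \<and> b \<in> B s) = s"
        using that B(4) by (intro the_equality) (auto simp: disjoint_family_on_def)
      moreover have "b \<notin> B0" using that B(2) by blast
      moreover have "\<phi> b = w b" using \<phi>(2) that by blast
      ultimately show ?thesis by (simp add: w_def)
    qed
    moreover have "\<phi> k = 0" if "k \<in> K" for k
      using that B(1) \<phi>(2) by (intro pair.linear_eq_0_on_span[OF \<phi>(1), of B0 k]) (auto simp: w_def)
    ultimately show ?thesis using \<phi>(1) by blast
  qed
  moreover have "independent (B s)" if "s \<in> S" for s
    using independent_mono[OF B(3)] that by blast
  ultimately show ?thesis
    using B(2) by (intro that[of B]) simp_all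
qed

text \<open>The combinations on the right form a subspace containing all generators. Coefficients
  belong to pairs \<open>(f, i)\<close> rather than to vectors, because the same vector may be
  listed under several links; this is also the shape of the coefficients of a linear code.\<close>

lemma span_Un_UN_explicit:
  assumes "finite I" "w \<in> span (K \<union> (\<Union>f\<in>I. v f ` {..<d f :: nat}))"
  obtains k c where "k \<in> span K" "w = k + (\<Sum>f\<in>I. \<Sum>i<d f. scale (c f i) (v f i))"
proof -
  let ?R = "{k + (\<Sum>f\<in>I. \<Sum>i<d f. scale (c f i) (v f i)) |k c. k \<in> span K}"
  have "subspace ?R"
  proof (rule subspaceI)
    show "0 \<in> ?R"
      by (intro CollectI exI[of _ 0] exI[of _ "\<lambda>_ _. 0"]) (auto simp: span_zero)
  next
    fix x y assume "x \<in> ?R" "y \<in> ?R"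
    then obtain k c k' c' where *: "k \<in> span K" "k' \<in> span K"
      "x = k + (\<Sum>f\<in>I. \<Sum>i<d f. scale (c f i) (v f i))"
      "y = k' + (\<Sum>f\<in>I. \<Sum>i<d f. scale (c' f i) (v f i))" by blast
    show "x + y \<in> ?R"
      by (intro CollectI exI[of _ "k + k'"] exI[of _ "\<lambda>f i. c f i + c' f i"])
         (auto simp: * span_add scale_left_distrib sum.distrib algebra_simps)
  next
    fix a x assume "x \<in> ?R"
    then obtain k c where *: "k \<in> span K"
      "x = k + (\<Sum>f\<in>I. \<Sum>i<d f. scale (c f i) (v f i))" by blast
    show "scale a x \<in> ?R"
      by (intro CollectI exI[of _ "scale a k"] exI[of _ "\<lambda>f i. a * c f i"])
         (auto simp: * span_scale scale_right_distrib scale_sum_right)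
  qed
  moreover have "K \<union> (\<Union>f\<in>I. v f ` {..<d f}) \<subseteq> ?R"
  proof
    fix x assume "x \<in> K \<union> (\<Union>f\<in>I. v f ` {..<d f})"
    then consider "x \<in> K" | f i where "f \<in> I" "i < d f" "x = v f i" by blast
    then show "x \<in> ?R"
    proof cases
      case 1
      then show ?thesis
        by (intro CollectI exI[of _ x] exI[of _ "\<lambda>_ _. 0"]) (auto simp: span_base)
    next
      case (2 g j)
      have "(\<Sum>f\<in>I. \<Sum>i<d f. scale (if f = g \<and> i = j then 1 else 0) (v f i)) =
          (\<Sum>f\<in>I. if f = g then v g j else 0)"
      proof (rule sum.cong[OF refl])
        fix f assume "f \<in> I"
        show "(\<Sum>i<d f. scale (if f = g \<and> i = j then 1 else 0) (v f i)) = (if f = g then v g j else 0)"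
        proof (cases "f = g")
          case True
          have "(\<Sum>i<d f. scale (if f = g \<and> i = j then 1 else 0) (v f i)) = (\<Sum>i<d g. if i = j then v g i else 0)"
            unfolding True by (rule sum.cong) auto
          also have "\<dots> = v g j" using 2 by simp
          finally show ?thesis using True by simp
        qed auto
      qed
      then have "(\<Sum>f\<in>I. \<Sum>i<d f. scale (if f = g \<and> i = j then 1 else 0) (v f i)) = x"
        using 2 assms(1) by simp
      then show ?thesis
        by (intro CollectI exI[of _ 0] exI[of _ "\<lambda>f i. if f = g \<and> i = j then 1 else 0"])
           (auto simp: span_zero)
    qed
  qed
  ultimately have "span (K \<union> (\<Union>f\<in>I. v f ` {..<d f})) \<subseteq> ?R"
    by (rule span_minimal[rotated])
  with assms(2) that show ?thesis by blast
qed

end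

section \<open>Vectors and functionals over a finite field\<close>

interpretation functional: vector_space_pair
  "fscale :: 'k::field \<Rightarrow> (nat \<Rightarrow> 'k) \<Rightarrow> (nat \<Rightarrow> 'k)" "(*) :: 'k \<Rightarrow> 'k \<Rightarrow> 'k"
  by unfold_locales (auto simp: algebra_simps)

abbreviation linear_functional :: "((nat \<Rightarrow> 'k::field) \<Rightarrow> 'k) \<Rightarrow> bool" where
  "linear_functional \<equiv> Vector_Spaces.linear fscale (*)"

section \<open>Counting vectors, and elementary facts on links and source outcomes\<close>

lemma card_field_gt_1: "CARD('k::{finite,field}) > 1"
proof -
  have "card {0, 1 :: 'k} \<le> CARD('k)" by (rule card_mono) auto
  then show ?thesis by simp
qed

lemma bij_betw_vecs:
  "bij_betw (\<lambda>g i. if i < m then g i else 0) ({..<m} \<rightarrow>\<^sub>E (UNIV :: 'k::zero set)) (vecs m)"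
proof (rule bij_betwI[where g = "\<lambda>f. restrict f {..<m}"])
  show "(\<lambda>g i. if i < m then g i else 0) \<in> ({..<m} \<rightarrow>\<^sub>E UNIV) \<rightarrow> vecs m"
    by (auto simp: vecs_def)
qed (auto simp: vecs_def fun_eq_iff PiE_def extensional_def)

lemma card_vecs: "card (vecs m :: (nat \<Rightarrow> 'k::{finite,zero}) set) = CARD('k) ^ m"
  using bij_betw_same_card[OF bij_betw_vecs[of m, where 'k = 'k]]
  by (simp add: card_funcsetE)

lemma finite_vecs: "finite (vecs m :: (nat \<Rightarrow> 'k::{finite,zero}) set)"
  using bij_betw_finite[OF bij_betw_vecs[of m, where 'k = 'k]]
  by (simp add: finite_PiE)

lemma finite_links: "finite S \<Longrightarrow> finite E \<Longrightarrow> finite (links S E)"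
  by (simp add: links_def)

lemma in_edge_subset: "in_edge S E tail head Og e \<subseteq> links S E"
  by (auto simp: in_edge_def)

lemma in_node_subset: "in_node S E head Og u \<subseteq> links S E"
  by (auto simp: in_node_def)

lemma sample_space_vecs: "x \<in> sample_space S d \<Longrightarrow> s \<in> S \<Longrightarrow> x s \<in> vecs (d (Inl s))"
  by (simp add: sample_space_def)

lemma image_sample_space:
  assumes "s \<in> S"
  shows "(\<lambda>x. x s) ` sample_space S d = (vecs (d (Inl s)) :: (nat \<Rightarrow> 'k::zero) set)"
proof
  show "(\<lambda>x. x s) ` sample_space S d \<subseteq> vecs (d (Inl s))"
    using assms by (auto simp: sample_space_def)
  show "vecs (d (Inl s)) \<subseteq> (\<lambda>x. x s) ` (sample_space S d :: ('a \<Rightarrow> nat \<Rightarrow> 'k) set)"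
  proof
    fix f :: "nat \<Rightarrow> 'k" assume "f \<in> vecs (d (Inl s))"
    then show "f \<in> (\<lambda>x. x s) ` sample_space S d"
      using assms
      by (intro image_eqI[of _ _ "(\<lambda>_ _. 0)(s := f)"]) (auto simp: sample_space_def vecs_def)
  qed
qed

section \<open>From representable functions to codes\<close>

text \<open>The hypothesis \<open>edge\<close> yields the encoding coefficients and
  \<open>sink\<close> the decodability. For a source, the chosen vectors only complete
  \<open>K\<close> to a spanning set of \<open>U (Inl s)\<close>, whence the loss of at most
  \<open>card K\<close> in length. For an edge only an upper bound on the support results, since the
  functionals used need not take all values on its basis.\<close>

lemma exists_code_modulo:
  fixes U :: "'s + 'e \<Rightarrow> (nat \<Rightarrow> 'k::{finite,field}) set"
  assumes finS: "finite S" and finE: "finite E"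
    and U: "\<And>f. f \<in> links S E \<Longrightarrow> fvs.subspace (U f) \<and> finite (U f)"
    and K: "finite K"
    and indep: "\<And>s. s \<in> S \<Longrightarrow> U (Inl s) \<inter> fvs.span (K \<union> (\<Union>t\<in>S-{s}. U (Inl t))) \<subseteq> fvs.span K"
    and edge: "\<And>e. e \<in> E \<Longrightarrow> U (Inr e) \<subseteq> fvs.span (K \<union> (\<Union>f\<in>in_edge S E tail head Og e. U f))"
    and sink: "\<And>s u. s \<in> S \<Longrightarrow> u \<in> D s \<Longrightarrow>
      U (Inl s) \<subseteq> fvs.span (K \<union> (\<Union>f\<in>in_node S E head Og u. U f))"
  obtains d and Y :: "'s + 'e \<Rightarrow> ('s \<Rightarrow> nat \<Rightarrow> 'k) \<Rightarrow> (nat \<Rightarrow> 'k)" where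
    "linear_code S E tail head Og d Y"
    "\<And>s u. s \<in> S \<Longrightarrow> u \<in> D s \<Longrightarrow> cond_entropy_zero S d Y (Inl s) (in_node S E head Og u)"
    "\<And>s. s \<in> S \<Longrightarrow> supp_size S d Y (Inl s) = CARD('k) ^ d (Inl s)"
    "\<And>s. s \<in> S \<Longrightarrow> d (Inl s) \<le> fvs.dim (U (Inl s)) \<and> fvs.dim (U (Inl s)) \<le> d (Inl s) + card K"
    "\<And>e. e \<in> E \<Longrightarrow> supp_size S d Y (Inr e) \<le> CARD('k) ^ fvs.dim (U (Inr e))"
proof -
  obtain Bs where Bs: "\<And>s. s \<in> S \<Longrightarrow> Bs s \<subseteq> U (Inl s) \<and> U (Inl s) \<subseteq> fvs.span (K \<union> Bs s) \<and>
      fvs.independent (Bs s)"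
    and interp: "\<And>y. \<exists>\<phi>. linear_functional \<phi> \<and> (\<forall>k\<in>K. \<phi> k = 0) \<and> (\<forall>s\<in>S. \<forall>b\<in>Bs s. \<phi> b = y s b)"
  proof (rule fvs.exists_interpolating_system[of S "\<lambda>s. U (Inl s)" K])
    show "fvs.subspace (U (Inl s))" if "s \<in> S" for s
      using U that by (simp add: links_def)
  qed (use finS indep in \<open>blast+\<close>)
  \<comment> \<open>Values on edges are derived from the functional rather than prescribed, so an
    ordinary basis of \<open>U (Inr e)\<close> serves here.\<close>
  have "\<exists>B. B \<subseteq> U (Inr e) \<and> fvs.independent B \<and> U (Inr e) \<subseteq> fvs.span B" for e
    by (rule fvs.maximal_independent_subset[of "U (Inr e)"]) blast
  then obtain Be where Be: "\<And>e. Be e \<subseteq> U (Inr e) \<and> fvs.independent (Be e) \<and> U (Inr e) \<subseteq> fvs.span (Be e)"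
    by metis
  define B where "B f = (case f of Inl s \<Rightarrow> Bs s | Inr e \<Rightarrow> Be e)" for f :: "'s + 'e"
  have B: "B f \<subseteq> U f" "U f \<subseteq> fvs.span (K \<union> B f)" "fvs.independent (B f)" if "f \<in> links S E" for f
    using that Bs Be fvs.span_mono[of "Be e" "K \<union> Be e" for e]
    by (auto simp: B_def links_def; blast)+
  have finB: "finite (B f)" if "f \<in> links S E" for f
    using B(1) U that finite_subset by blast
  define d where "d f = card (B f)" for f
  have "\<exists>v. bij_betw v {..<d f} (B f)" if "f \<in> links S E" for f
    using ex_bij_betw_nat_finite[OF finB[OF that]] by (simp add: d_def atLeast0LessThan)
  then obtain v where v: "\<And>f. f \<in> links S E \<Longrightarrow> bij_betw (v f) {..<d f} (B f)"
    by metis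
  have vB: "v f ` {..<d f} = B f" if "f \<in> links S E" for f
    using v[OF that] by (rule bij_betw_imp_surj_on)
  \<comment> \<open>The inverse of the enumeration \<open>v\<close> returns the index of
    \<open>b\<close>, so the \<open>j\<close>-th basis vector of source \<open>s\<close> receives
    the \<open>j\<close>-th entry of \<open>x s\<close>.\<close>
  have "\<forall>x :: 's \<Rightarrow> nat \<Rightarrow> 'k. \<exists>\<phi>. linear_functional \<phi> \<and> (\<forall>k\<in>K. \<phi> k = 0) \<and>
      (\<forall>s\<in>S. \<forall>b\<in>Bs s. \<phi> b = x s (inv_into {..<d (Inl s)} (v (Inl s)) b))"
    by (intro allI interp)
  then obtain \<phi> where \<phi>: "\<And>x :: 's \<Rightarrow> nat \<Rightarrow> 'k. linear_functional (\<phi> x)" "\<And>x k. k \<in> K \<Longrightarrow> \<phi> x k = 0"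
    and \<phi>B: "\<And>x s b. s \<in> S \<Longrightarrow> b \<in> Bs s \<Longrightarrow> \<phi> x b = x s (inv_into {..<d (Inl s)} (v (Inl s)) b)"
    by metis
  have \<phi>K: "\<phi> x k = 0" if "k \<in> fvs.span K" for x k
    using functional.linear_eq_0_on_span[OF \<phi>(1) _ that] \<phi>(2) by blast
  have \<phi>v: "\<phi> x (v (Inl s) j) = x s j" if "s \<in> S" "j < d (Inl s)" for x s j
  proof -
    have l: "Inl s \<in> links S E" using that by (simp add: links_def)
    have "v (Inl s) j \<in> Bs s"
      using vB[OF l] that by (auto simp: B_def)
    then show ?thesis
      using \<phi>B[OF that(1)] bij_betw_imp_inj_on[OF v[OF l]] that by simp
  qed
  \<comment> \<open>\<open>\<phi> x\<close> need not be linear in \<open>x\<close>: relations between the vectors \<open>v f i\<close> modulo \<open>K\<close> are inherited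
    by the values of any functional vanishing on \<open>K\<close>.\<close>
  define Y where "Y f x = (\<lambda>j. if j < d f then \<phi> x (v f j) else 0)" for f x
  have span_B: "fvs.span (K \<union> (\<Union>f\<in>A. U f)) \<subseteq> fvs.span (K \<union> (\<Union>f\<in>A. B f))" if "A \<subseteq> links S E" for A
  proof (rule fvs.span_minimal)
    have "U f \<subseteq> fvs.span (K \<union> (\<Union>f\<in>A. B f))" if "f \<in> A" for f
      using B(2)[of f] \<open>A \<subseteq> _\<close> that fvs.span_mono[of "K \<union> B f" "K \<union> (\<Union>f\<in>A. B f)"] by blast
    then show "K \<union> (\<Union>f\<in>A. U f) \<subseteq> fvs.span (K \<union> (\<Union>f\<in>A. B f))"
      using fvs.span_superset[of "K \<union> (\<Union>f\<in>A. B f)"] by blast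
  qed simp
  have Ysrc: "Y (Inl s) x = x s" if "s \<in> S" "x \<in> sample_space S d" for s x
    using \<phi>v[OF that(1)] sample_space_vecs[OF that(2,1)] by (auto simp: Y_def vecs_def fun_eq_iff)
  have "linear_code S E tail head Og d Y"
    unfolding linear_code_def
  proof (intro conjI ballI)
    fix s and x :: "'s \<Rightarrow> nat \<Rightarrow> 'k" assume "s \<in> S" "x \<in> sample_space S d"
    then show "Y (Inl s) x = x s" by (rule Ysrc)
  next
    fix e assume e: "e \<in> E"
    let ?I = "in_edge S E tail head Og e"
    have sub: "?I \<subseteq> links S E" by (rule in_edge_subset)
    have finI: "finite ?I"
      using finite_subset[OF sub] finite_links[OF finS finE] by blast
    \<comment> \<open>Remainder in \<open>span K\<close> and coefficients are packed into one pair,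
      so that a single choice over \<open>j\<close> fixes both; the coefficients are thereby
      independent of the outcome.\<close>
    have "\<forall>j\<in>{..<d (Inr e)}. \<exists>p. fst p \<in> fvs.span K \<and>
        v (Inr e) j = fst p + (\<Sum>f\<in>?I. \<Sum>i<d f. fscale (snd p f i) (v f i))"
    proof
      fix j assume j: "j \<in> {..<d (Inr e)}"
      have l: "Inr e \<in> links S E" using e by (simp add: links_def)
      have "v (Inr e) j \<in> U (Inr e)"
        using vB[OF l] j B(1)[OF l] by blast
      then have "v (Inr e) j \<in> fvs.span (K \<union> (\<Union>f\<in>?I. B f))"
        using edge[OF e] span_B[OF sub] by blast
      also have "(\<Union>f\<in>?I. B f) = (\<Union>f\<in>?I. v f ` {..<d f})"
        using vB sub by (intro SUP_cong) auto
      finally obtain k c where "k \<in> fvs.span K"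
        "v (Inr e) j = k + (\<Sum>f\<in>?I. \<Sum>i<d f. fscale (c f i) (v f i))"
        by (rule fvs.span_Un_UN_explicit[OF finI])
      then show "\<exists>p. fst p \<in> fvs.span K \<and>
        v (Inr e) j = fst p + (\<Sum>f\<in>?I. \<Sum>i<d f. fscale (snd p f i) (v f i))"
        by (intro exI[of _ "(k, c)"]) simp
    qed
    from bchoice[OF this] obtain p where p: "\<forall>j\<in>{..<d (Inr e)}. fst (p j) \<in> fvs.span K \<and>
        v (Inr e) j = fst (p j) + (\<Sum>f\<in>?I. \<Sum>i<d f. fscale (snd (p j) f i) (v f i))" ..
    define k c where "k j = fst (p j)" and "c j = snd (p j)" for j
    have kc: "k j \<in> fvs.span K \<and> v (Inr e) j = k j + (\<Sum>f\<in>?I. \<Sum>i<d f. fscale (c j f i) (v f i))"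
      if "j < d (Inr e)" for j
      using p that by (simp add: k_def c_def)
    show "\<exists>c. \<forall>x\<in>sample_space S d. Y (Inr e) x =
        (\<lambda>j. if j < d (Inr e) then (\<Sum>f\<in>?I. \<Sum>i<d f. c f i j * Y f x i) else 0)"
    proof (intro exI ballI ext)
      fix x :: "'s \<Rightarrow> nat \<Rightarrow> 'k" and j
      have "\<phi> x (v (Inr e) j) = (\<Sum>f\<in>?I. \<Sum>i<d f. c j f i * Y f x i)" if j: "j < d (Inr e)"
      proof -
        have "\<phi> x (v (Inr e) j) = \<phi> x (k j + (\<Sum>f\<in>?I. \<Sum>i<d f. fscale (c j f i) (v f i)))"
          using kc[OF j] by simp
        also have "\<dots> = (\<Sum>f\<in>?I. \<Sum>i<d f. c j f i * \<phi> x (v f i))"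
          using kc[OF j] \<phi>K
          by (simp add: functional.linear_add[OF \<phi>(1)] functional.linear_sum[OF \<phi>(1)]
              functional.linear_scale[OF \<phi>(1)])
        finally show ?thesis by (simp add: Y_def)
      qed
      then show "Y (Inr e) x j =
        (if j < d (Inr e) then (\<Sum>f\<in>?I. \<Sum>i<d f. (\<lambda>f i j. c j f i) f i j * Y f x i) else 0)"
        by (simp add: Y_def)
    qed
  qed
  moreover have "cond_entropy_zero S d Y (Inl s) (in_node S E head Og u)" if s: "s \<in> S" and u: "u \<in> D s" for s u
    unfolding cond_entropy_zero_def
  proof (intro ballI impI)
    fix x x' assume eq: "\<forall>f\<in>in_node S E head Og u. Y f x = Y f x'"
    let ?I = "in_node S E head Og u"
    have sub: "?I \<subseteq> links S E" by (rule in_node_subset)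
    have l: "Inl s \<in> links S E" using s by (simp add: links_def)
    have eqv: "\<phi> x (v f i) = \<phi> x' (v f i)" if "f \<in> ?I" "i < d f" for f i
    proof -
      have "Y f x i = Y f x' i" using eq that(1) by simp
      then show ?thesis using that(2) by (simp add: Y_def)
    qed
    \<comment> \<open>Both functionals vanish on \<open>K\<close> and agree on the incoming bases,
      hence on their whole span, which contains \<open>U (Inl s)\<close> by
      \<open>sink\<close>.\<close>
    have "\<phi> x w = \<phi> x' w" if "w \<in> K \<union> (\<Union>f\<in>?I. B f)" for w
    proof -
      have "\<phi> x w = \<phi> x' w" if "f \<in> ?I" "w \<in> B f" for f
      proof -
        have "w \<in> v f ` {..<d f}" using that vB[of f] sub by blast
        then show ?thesis using eqv[OF that(1)] by auto
      qed
      then show ?thesis using that \<phi>(2) by auto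
    qed
    note eqB = functional.linear_eq_on[OF \<phi>(1) \<phi>(1) _ this]
    have "\<phi> x (v (Inl s) j) = \<phi> x' (v (Inl s) j)" if "j < d (Inl s)" for j
    proof (rule eqB)
      have "v (Inl s) j \<in> U (Inl s)"
        using vB[OF l] that B(1)[OF l] by blast
      then show "v (Inl s) j \<in> fvs.span (K \<union> (\<Union>f\<in>?I. B f))"
        using sink[OF s u] span_B[OF sub] by blast
    qed
    then show "Y (Inl s) x = Y (Inl s) x'"
      by (auto simp: Y_def)
  qed
  moreover have "supp_size S d Y (Inl s) = CARD('k) ^ d (Inl s)" if "s \<in> S" for s
  proof -
    have "Y (Inl s) ` sample_space S d = (\<lambda>x. x s) ` sample_space S d"
      using Ysrc[OF that] by (rule image_cong[OF refl])
    then show ?thesis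
      by (simp add: supp_size_def image_sample_space[OF that] card_vecs)
  qed
  moreover have "d (Inl s) \<le> fvs.dim (U (Inl s)) \<and> fvs.dim (U (Inl s)) \<le> d (Inl s) + card K" if "s \<in> S" for s
  proof
    have l: "Inl s \<in> links S E" using that by (simp add: links_def)
    show "d (Inl s) \<le> fvs.dim (U (Inl s))"
      unfolding d_def using B[OF l] U[OF l] by (intro fvs.independent_card_le_dim_finite) auto
    have "fvs.dim (U (Inl s)) \<le> card (K \<union> B (Inl s))"
      using B(2)[OF l] finB[OF l] K by (intro fvs.dim_le_card) auto
    also have "\<dots> \<le> d (Inl s) + card K"
      unfolding d_def by (metis add.commute card_Un_le)
    finally show "fvs.dim (U (Inl s)) \<le> d (Inl s) + card K" .
  qed
  moreover have "supp_size S d Y (Inr e) \<le> CARD('k) ^ fvs.dim (U (Inr e))" if "e \<in> E" for e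
  proof -
    have l: "Inr e \<in> links S E" using that by (simp add: links_def)
    have "Y (Inr e) ` sample_space S d \<subseteq> vecs (d (Inr e))"
      by (auto simp: Y_def vecs_def)
    then have "supp_size S d Y (Inr e) \<le> CARD('k) ^ d (Inr e)"
      unfolding supp_size_def card_vecs[symmetric] by (intro card_mono finite_vecs)
    also have "d (Inr e) \<le> fvs.dim (U (Inr e))"
      unfolding d_def using B[OF l] U[OF l] by (intro fvs.independent_card_le_dim_finite) auto
    then have "CARD('k) ^ d (Inr e) \<le> CARD('k) ^ fvs.dim (U (Inr e))"
      by (intro power_increasing) auto
    finally show ?thesis .
  qed
  ultimately show ?thesis by (rule that)
qed

text \<open>Here \<open>\<delta>\<close> is the total violation of the edge and sink constraints and
  \<open>\<gamma>\<close> that of source independence. Relative bases for all edge and sink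
  constraints give a set \<open>F\<close> of at most \<open>\<delta>\<close> vectors; making the
  sources independent modulo \<open>F\<close> then costs at most \<open>card S\<close> times
  \<open>\<delta> + \<gamma>\<close> further vectors.\<close>

lemma exists_repaired_code:
  fixes U :: "'s + 'e \<Rightarrow> (nat \<Rightarrow> 'k::{finite,field}) set"
  assumes finS: "finite S" and finE: "finite E" and finD: "\<And>s. s \<in> S \<Longrightarrow> finite (D s)"
    and U: "\<And>f. f \<in> links S E \<Longrightarrow> fvs.subspace (U f) \<and> finite (U f)"
    and h: "\<And>\<alpha>. h \<alpha> = real (fvs.dim (\<Union>f\<in>\<alpha>. U f))"
    and \<delta>: "\<delta> = (\<Sum>e\<in>E. h ({Inr e} \<union> in_edge S E tail head Og e) - h (in_edge S E tail head Og e))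
      + (\<Sum>s\<in>S. \<Sum>u\<in>D s. h ({Inl s} \<union> in_node S E head Og u) - h (in_node S E head Og u))"
    and \<gamma>: "\<gamma> = (\<Sum>s\<in>S. h {Inl s}) - h (Inl ` S)"
  obtains d and Y :: "'s + 'e \<Rightarrow> ('s \<Rightarrow> nat \<Rightarrow> 'k) \<Rightarrow> (nat \<Rightarrow> 'k)" where
    "linear_code S E tail head Og d Y"
    "\<And>s u. s \<in> S \<Longrightarrow> u \<in> D s \<Longrightarrow> cond_entropy_zero S d Y (Inl s) (in_node S E head Og u)"
    "\<And>s. s \<in> S \<Longrightarrow> supp_size S d Y (Inl s) = CARD('k) ^ d (Inl s)"
    "\<And>s. s \<in> S \<Longrightarrow> real (d (Inl s)) \<le> h {Inl s} \<and>
       h {Inl s} \<le> real (d (Inl s)) + (\<delta> + real (card S) * (\<delta> + \<gamma>))"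
    "\<And>e. e \<in> E \<Longrightarrow> real (supp_size S d Y (Inr e)) \<le> real CARD('k) powr h {Inr e}"
proof -
  have finU: "finite (\<Union>f\<in>A. U f)" if "A \<subseteq> links S E" for A
    using finite_subset[OF that finite_links[OF finS finE]] U that by blast
  have rel: "\<exists>F. finite F \<and> U g \<subseteq> fvs.span (F \<union> (\<Union>f\<in>A. U f)) \<and> real (card F) = h ({g} \<union> A) - h A"
    if gl: "g \<in> links S E" and Al: "A \<subseteq> links S E" for g A
  proof -
    obtain F where F: "F \<subseteq> U g" "U g \<subseteq> fvs.span ((\<Union>f\<in>A. U f) \<union> F)"
      "card F + fvs.dim (\<Union>f\<in>A. U f) = fvs.dim ((\<Union>f\<in>A. U f) \<union> U g)"
      using fvs.exists_relative_basis[of "\<Union>f\<in>A. U f" "U g"] finU[OF Al] U[OF gl] by blast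
    have "finite F" using F(1) U[OF gl] finite_subset by blast
    moreover have "real (card F) = h ({g} \<union> A) - h A"
      unfolding h using F(3) by (simp add: Un_commute flip: of_nat_add)
    ultimately show ?thesis using F(2) by (auto simp: Un_commute)
  qed
  have "\<exists>F. finite F \<and> U (Inr e) \<subseteq> fvs.span (F \<union> (\<Union>f\<in>in_edge S E tail head Og e. U f)) \<and>
      real (card F) = h ({Inr e} \<union> in_edge S E tail head Og e) - h (in_edge S E tail head Og e)" if "e \<in> E" for e
    using that by (intro rel in_edge_subset) (simp add: links_def)
  then obtain Fe where Fe: "\<And>e. e \<in> E \<Longrightarrow> finite (Fe e) \<and>
      U (Inr e) \<subseteq> fvs.span (Fe e \<union> (\<Union>f\<in>in_edge S E tail head Og e. U f)) \<and>
      real (card (Fe e)) = h ({Inr e} \<union> in_edge S E tail head Og e) - h (in_edge S E tail head Og e)"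
    by metis
  have "\<exists>F. finite F \<and> U (Inl s) \<subseteq> fvs.span (F \<union> (\<Union>f\<in>in_node S E head Og u. U f)) \<and>
      real (card F) = h ({Inl s} \<union> in_node S E head Og u) - h (in_node S E head Og u)" if "s \<in> S" for s u
    using that by (intro rel in_node_subset) (simp add: links_def)
  then obtain Fs where Fs: "\<And>s u. s \<in> S \<Longrightarrow> finite (Fs s u) \<and>
      U (Inl s) \<subseteq> fvs.span (Fs s u \<union> (\<Union>f\<in>in_node S E head Og u. U f)) \<and>
      real (card (Fs s u)) = h ({Inl s} \<union> in_node S E head Og u) - h (in_node S E head Og u)"
    by metis
  define F where "F = (\<Union>e\<in>E. Fe e) \<union> (\<Union>s\<in>S. \<Union>u\<in>D s. Fs s u)"
  have finF: "finite F"
    using finS finE finD Fe Fs by (auto simp: F_def)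
  have cardF: "real (card F) \<le> \<delta>"
  proof -
    have "card F \<le> card (\<Union>e\<in>E. Fe e) + card (\<Union>s\<in>S. \<Union>u\<in>D s. Fs s u)"
      unfolding F_def by (rule card_Un_le)
    also have "card (\<Union>e\<in>E. Fe e) \<le> (\<Sum>e\<in>E. card (Fe e))"
      by (rule card_UN_le[OF finE])
    also have "card (\<Union>s\<in>S. \<Union>u\<in>D s. Fs s u) \<le> (\<Sum>s\<in>S. card (\<Union>u\<in>D s. Fs s u))"
      by (rule card_UN_le[OF finS])
    also have "\<dots> \<le> (\<Sum>s\<in>S. \<Sum>u\<in>D s. card (Fs s u))"
      by (intro sum_mono card_UN_le finD)
    finally have "real (card F) \<le> (\<Sum>e\<in>E. real (card (Fe e))) + (\<Sum>s\<in>S. \<Sum>u\<in>D s. real (card (Fs s u)))"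
      by (simp flip: of_nat_sum of_nat_add)
    also have "\<dots> = \<delta>"
      unfolding \<delta> using Fe Fs by (intro arg_cong2[where f = "(+)"] sum.cong) auto
    finally show ?thesis .
  qed
  \<comment> \<open>Subadditivity, \<open>dimS\<close> below, keeps this natural subtraction from
    truncating, so \<open>real g\<close> is \<open>\<gamma>\<close>.\<close>
  define g where "g = (\<Sum>s\<in>S. fvs.dim (U (Inl s))) - fvs.dim (\<Union>s\<in>S. U (Inl s))"
  have dimS: "fvs.dim (\<Union>s\<in>S. U (Inl s)) \<le> (\<Sum>s\<in>S. fvs.dim (U (Inl s)))"
    using fvs.dim_Un_UN_le[of "{}" S "\<lambda>s. U (Inl s)"] finS U by (simp add: links_def)
  have \<gamma>': "\<gamma> = real (\<Sum>s\<in>S. fvs.dim (U (Inl s))) - real (fvs.dim (\<Union>s\<in>S. U (Inl s)))"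
    unfolding \<gamma> h by (simp add: image_image)
  have g: "(\<Sum>s\<in>S. fvs.dim (U (Inl s))) = fvs.dim (\<Union>s\<in>S. U (Inl s)) + g"
    "real g = \<gamma>"
    using dimS unfolding g_def \<gamma>' by (auto simp: of_nat_diff)
  obtain K where K: "finite K" "F \<subseteq> K" "card K \<le> card F + card S * (card F + g)"
    "\<And>s. s \<in> S \<Longrightarrow> U (Inl s) \<inter> fvs.span (K \<union> (\<Union>t\<in>S-{s}. U (Inl t))) \<subseteq> fvs.span K"
  proof (rule fvs.exists_independence_modulo[OF finS finF, of "\<lambda>s. U (Inl s)" g])
    show "fvs.subspace (U (Inl s)) \<and> finite (U (Inl s))" if "s \<in> S" for s
      using U that by (simp add: links_def)
  qed (use g in auto)
  have cardK: "real (card K) \<le> \<delta> + real (card S) * (\<delta> + \<gamma>)"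
  proof -
    have "real (card K) \<le> real (card F + card S * (card F + g))"
      using K(3) by (rule of_nat_mono)
    also have "\<dots> = real (card F) + real (card S) * (real (card F) + \<gamma>)"
      using g(2) by simp
    also have "\<dots> \<le> \<delta> + real (card S) * (\<delta> + \<gamma>)"
      using cardF by (intro add_mono mult_left_mono) auto
    finally show ?thesis .
  qed
  have edge: "U (Inr e) \<subseteq> fvs.span (K \<union> (\<Union>f\<in>in_edge S E tail head Og e. U f))" if "e \<in> E" for e
  proof -
    have "Fe e \<subseteq> K" using K(2) that by (auto simp: F_def)
    then show ?thesis
      using Fe[OF that] fvs.span_mono[OF Un_mono[OF _ subset_refl], of "Fe e" K] by blast
  qed
  have sink: "U (Inl s) \<subseteq> fvs.span (K \<union> (\<Union>f\<in>in_node S E head Og u. U f))" if "s \<in> S" "u \<in> D s" for s u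
  proof -
    have "Fs s u \<subseteq> K" using K(2) that unfolding F_def by blast
    then show ?thesis
      using Fs[OF that(1), of u] fvs.span_mono[OF Un_mono[OF _ subset_refl], of "Fs s u" K] by blast
  qed
  have h1: "h {f} = real (fvs.dim (U f))" for f
    by (simp add: h)
  show ?thesis
  proof (rule exists_code_modulo[OF finS finE U K(1) K(4) edge sink])
    fix d and Y :: "'s + 'e \<Rightarrow> ('s \<Rightarrow> nat \<Rightarrow> 'k) \<Rightarrow> (nat \<Rightarrow> 'k)"
    assume code: "linear_code S E tail head Og d Y"
      "\<And>s u. s \<in> S \<Longrightarrow> u \<in> D s \<Longrightarrow> cond_entropy_zero S d Y (Inl s) (in_node S E head Og u)"
      "\<And>s. s \<in> S \<Longrightarrow> supp_size S d Y (Inl s) = CARD('k) ^ d (Inl s)"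
      "\<And>s. s \<in> S \<Longrightarrow> d (Inl s) \<le> fvs.dim (U (Inl s)) \<and> fvs.dim (U (Inl s)) \<le> d (Inl s) + card K"
      "\<And>e. e \<in> E \<Longrightarrow> supp_size S d Y (Inr e) \<le> CARD('k) ^ fvs.dim (U (Inr e))"
    show ?thesis
    proof (rule that[OF code(1-3)])
      fix s assume "s \<in> S"
      from code(4)[OF this] show "real (d (Inl s)) \<le> h {Inl s} \<and>
         h {Inl s} \<le> real (d (Inl s)) + (\<delta> + real (card S) * (\<delta> + \<gamma>))"
        using cardK unfolding h1 by linarith
    next
      fix e assume "e \<in> E"
      from code(5)[OF this] have "real (supp_size S d Y (Inr e)) \<le> real (CARD('k) ^ fvs.dim (U (Inr e)))"
        by (rule of_nat_mono)
      then show "real (supp_size S d Y (Inr e)) \<le> real CARD('k) powr h {Inr e}"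
        unfolding h1 by (simp add: powr_realpow)
    qed
  qed
qed

section \<open>Convergent subsequences, approximation and achievability\<close>

text \<open>Bolzano-Weierstrass, one sequence at a time: each new sequence is thinned to a monotone
  bounded one, and the limits obtained before survive the thinning.\<close>

lemma exists_common_convergent_subseq:
  fixes a :: "'e \<Rightarrow> nat \<Rightarrow> real"
  assumes "finite E" "\<And>e. e \<in> E \<Longrightarrow> Bseq (a e)"
  shows "\<exists>r :: nat \<Rightarrow> nat. strict_mono r \<and> (\<forall>e\<in>E. convergent (a e \<circ> r))"
  using assms
proof (induction E rule: finite_induct)
  case empty
  show ?case by (auto intro: strict_mono_id)
next
  case (insert e E)
  then obtain r :: "nat \<Rightarrow> nat" where r: "strict_mono r" "\<forall>e\<in>E. convergent (a e \<circ> r)"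
    by blast
  obtain r' :: "nat \<Rightarrow> nat" where r': "strict_mono r'" "monoseq (\<lambda>n. (a e \<circ> r) (r' n))"
    using seq_monosub by metis
  have "Bseq (\<lambda>n. (a e \<circ> r) (r' n))"
    using Bseq_subseq[of "a e" "\<lambda>n. r (r' n)"] insert.prems by (simp add: o_def)
  then have "convergent (a e \<circ> (r \<circ> r'))"
    using Bseq_monoseq_convergent[OF _ r'(2)] by (simp add: o_def)
  moreover have "convergent (a f \<circ> (r \<circ> r'))" if "f \<in> E" for f
    using convergent_subseq_convergent[OF bspec[OF r(2) that] r'(1)] by (simp add: o_assoc)
  ultimately show ?case
    using strict_mono_o[OF r(1) r'(1)] by (intro exI[of _ "r \<circ> r'"]) (simp del: o_apply)
qed

text \<open>As \<open>N\<close> has finitely many subsets, a single index of the approximating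
  sequence is good for all of them. The factor \<open>a\<close> is the one from weak
  representability.\<close>

lemma almost_q_representable_approx:
  assumes "almost_q_representable TYPE('k::{finite,field}) N h" "finite N" "\<epsilon> > 0"
  shows "\<exists>(U :: 'i \<Rightarrow> (nat \<Rightarrow> 'k) set) a. a > 0 \<and> (\<forall>i\<in>N. fvs.subspace (U i) \<and> finite (U i)) \<and>
    (\<forall>\<alpha>\<subseteq>N. \<bar>real (fvs.dim (\<Union>i\<in>\<alpha>. U i)) / a - h \<alpha>\<bar> < \<epsilon>)"
proof -
  obtain g where g: "\<And>n. weakly_q_representable TYPE('k) N (g n)"
    "\<And>\<alpha>. \<alpha> \<subseteq> N \<Longrightarrow> (\<lambda>n. g n \<alpha>) \<longlonglongrightarrow> h \<alpha>"
    using assms(1) unfolding almost_q_representable_def by blast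
  have "\<forall>\<^sub>F n in sequentially. \<forall>\<alpha>\<in>Pow N. \<bar>g n \<alpha> - h \<alpha>\<bar> < \<epsilon>"
    using assms(2) g(2) tendstoD[OF g(2) assms(3)]
    by (intro eventually_ball_finite) (auto simp: dist_real_def)
  then obtain n where n: "\<And>\<alpha>. \<alpha> \<subseteq> N \<Longrightarrow> \<bar>g n \<alpha> - h \<alpha>\<bar> < \<epsilon>"
    by (auto simp: eventually_sequentially)
  obtain a where a: "a > 0" "q_representable TYPE('k) N (\<lambda>\<alpha>. a * g n \<alpha>)"
    using g(1)[of n] unfolding weakly_q_representable_def by blast
  then obtain m and U :: "'i \<Rightarrow> (nat \<Rightarrow> 'k) set" where
    U: "\<And>i. i \<in> N \<Longrightarrow> fvs.subspace (U i) \<and> U i \<subseteq> vecs m"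
    "\<And>\<alpha>. \<alpha> \<subseteq> N \<Longrightarrow> a * g n \<alpha> = real (fvs.dim (\<Union>i\<in>\<alpha>. U i))"
    unfolding q_representable_def by blast
  have "\<bar>real (fvs.dim (\<Union>i\<in>\<alpha>. U i)) / a - h \<alpha>\<bar> < \<epsilon>" if "\<alpha> \<subseteq> N" for \<alpha>
    using n[OF that] a(1) by (simp flip: U(2)[OF that])
  moreover have "fvs.subspace (U i) \<and> finite (U i)" if "i \<in> N" for i
    using U(1)[OF that] finite_subset[OF _ finite_vecs] by blast
  ultimately show ?thesis
    using a(1) by (intro exI[of _ U] exI[of _ a]) blast
qed

text \<open>A diagonal argument: the \<open>n\<close>-th function is replaced by a scaled dimension
  function so close to it that the error vanishes even after multiplication by \<open>c n\<close>.
  The violations then vanish in the same scale, and so does the cost of the repair.\<close>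

lemma CL_imp_zero_achievable:
  fixes D :: "'s \<Rightarrow> 'v set" and E :: "'e set"
  assumes finS: "finite S" and finE: "finite E" and finD: "\<And>s. s \<in> S \<Longrightarrow> finite (D s)"
    and CL: "(lam, om) \<in> CL S E (proj ` (Upsilon_bar TYPE('k::{finite,field}) S E \<inter> C_I S
                                    \<inter> C_T S E tail head Og \<inter> C_D S E head Og D))"
  shows "zero_achievable_lin TYPE('k) E tail head S Og D lam om"
proof -
  let ?N = "links S E"
  let ?q = "real CARD('k)"
  have card: "CARD('k) > 1" by (rule card_field_gt_1)
  then have lnq: "ln ?q > 0" by simp
  obtain t c where t: "\<And>n. t n \<in> proj ` (Upsilon_bar TYPE('k) S E \<inter> C_I S \<inter> C_T S E tail head Og \<inter> C_D S E head Og D)"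
    and c: "\<And>n :: nat. c n > 0"
    and omt: "\<And>e. e \<in> E \<Longrightarrow> \<exists>L. (\<lambda>n. c n * snd (t n) e) \<longlonglongrightarrow> L \<and> L \<le> om e"
    and lamt: "\<And>s. s \<in> S \<Longrightarrow> \<exists>L. (\<lambda>n. c n * fst (t n) s) \<longlonglongrightarrow> L \<and> L \<ge> lam s"
    using CL unfolding CL_def by blast
  have "\<forall>n. \<exists>h. h \<in> Upsilon_bar TYPE('k) S E \<inter> C_I S \<inter> C_T S E tail head Og \<inter> C_D S E head Og D \<and> t n = proj h"
    using t by blast
  from choice[OF this] obtain h where h: "\<And>n. h n \<in> Upsilon_bar TYPE('k) S E \<inter> C_I S \<inter> C_T S E tail head Og \<inter> C_D S E head Og D"
    and th: "\<And>n. t n = proj (h n)"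
    by blast
  \<comment> \<open>The sequence \<open>c\<close> may be unbounded, so the tolerance is divided by
    \<open>c n\<close>; after scaling, an error of at most \<open>1 / real (Suc n)\<close>
    remains.\<close>
  have "\<forall>n. \<exists>p :: ('s + 'e \<Rightarrow> (nat \<Rightarrow> 'k) set) \<times> real. snd p > 0 \<and>
      (\<forall>i\<in>?N. fvs.subspace (fst p i) \<and> finite (fst p i)) \<and>
      (\<forall>\<alpha>\<subseteq>?N. \<bar>real (fvs.dim (\<Union>i\<in>\<alpha>. fst p i)) / snd p - h n \<alpha>\<bar> < 1 / (real (Suc n) * c n))"
  proof
    fix n
    have "almost_q_representable TYPE('k) ?N (h n)"
      using h[of n] by (simp add: Upsilon_bar_def)
    from almost_q_representable_approx[OF this finite_links[OF finS finE], of "1 / (real (Suc n) * c n)"]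
    show "\<exists>p :: ('s + 'e \<Rightarrow> (nat \<Rightarrow> 'k) set) \<times> real. snd p > 0 \<and>
      (\<forall>i\<in>?N. fvs.subspace (fst p i) \<and> finite (fst p i)) \<and>
      (\<forall>\<alpha>\<subseteq>?N. \<bar>real (fvs.dim (\<Union>i\<in>\<alpha>. fst p i)) / snd p - h n \<alpha>\<bar> < 1 / (real (Suc n) * c n))"
      using c[of n] by auto
  qed
  from choice[OF this] obtain p :: "nat \<Rightarrow> ('s + 'e \<Rightarrow> (nat \<Rightarrow> 'k) set) \<times> real" where
    p: "\<forall>n. snd (p n) > 0 \<and>
      (\<forall>i\<in>?N. fvs.subspace (fst (p n) i) \<and> finite (fst (p n) i)) \<and>
      (\<forall>\<alpha>\<subseteq>?N. \<bar>real (fvs.dim (\<Union>i\<in>\<alpha>. fst (p n) i)) / snd (p n) - h n \<alpha>\<bar> < 1 / (real (Suc n) * c n))" ..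
  define U where "U n = fst (p n)" for n
  define b where "b n = c n / snd (p n)" for n
  define r where "r n \<alpha> = real (fvs.dim (\<Union>i\<in>\<alpha>. U n i))" for n \<alpha>
  have b: "b n > 0" for n
    using p c by (simp add: b_def)
  have U: "fvs.subspace (U n f) \<and> finite (U n f)" if "f \<in> ?N" for n f
    using p that by (simp add: U_def)
  have approx: "(\<lambda>n. b n * r n \<alpha> - c n * h n \<alpha>) \<longlonglongrightarrow> 0" if "\<alpha> \<subseteq> ?N" for \<alpha>
  proof (rule tendsto_0_le[where K = 1])
    show "\<forall>\<^sub>F n in sequentially. norm (b n * r n \<alpha> - c n * h n \<alpha>) \<le> norm (1 / real (Suc n)) * 1"
    proof (rule always_eventually, rule allI)
      fix n
      have "b n * r n \<alpha> - c n * h n \<alpha> = c n * (r n \<alpha> / snd (p n) - h n \<alpha>)"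
        by (simp add: b_def right_diff_distrib)
      then have "norm (b n * r n \<alpha> - c n * h n \<alpha>) = c n * \<bar>r n \<alpha> / snd (p n) - h n \<alpha>\<bar>"
        using c[of n] by (simp add: abs_mult)
      also have "\<dots> \<le> c n * (1 / (real (Suc n) * c n))"
        using p that c[of n] by (intro mult_left_mono) (auto simp: r_def U_def less_imp_le)
      also have "\<dots> = 1 / real (Suc n)"
        using c[of n] by simp
      finally show "norm (b n * r n \<alpha> - c n * h n \<alpha>) \<le> norm (1 / real (Suc n)) * 1" by simp
    qed
    show "(\<lambda>n. 1 / real (Suc n)) \<longlonglongrightarrow> 0"
      using LIMSEQ_inverse_real_of_nat by (simp add: inverse_eq_divide)
  qed
  \<comment> \<open>Each constraint holds exactly for \<open>h n\<close>, so in the difference of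
    two approximations only the dimensions survive.\<close>
  have approx_diff: "(\<lambda>n. b n * (r n \<alpha> - r n \<beta>)) \<longlonglongrightarrow> 0"
    if "\<alpha> \<subseteq> ?N" "\<beta> \<subseteq> ?N" "\<And>n. h n \<alpha> - h n \<beta> = 0" for \<alpha> \<beta>
  proof -
    have "(\<lambda>n. (b n * r n \<alpha> - c n * h n \<alpha>) - (b n * r n \<beta> - c n * h n \<beta>)) \<longlonglongrightarrow> 0 - 0"
      by (intro tendsto_diff approx that)
    moreover have "(b n * r n \<alpha> - c n * h n \<alpha>) - (b n * r n \<beta> - c n * h n \<beta>) = b n * (r n \<alpha> - r n \<beta>)" for n
      using that(3)[of n] by (simp add: algebra_simps)
    ultimately show ?thesis by simp
  qed
  define \<delta> where "\<delta> n = (\<Sum>e\<in>E. r n ({Inr e} \<union> in_edge S E tail head Og e) - r n (in_edge S E tail head Og e))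
      + (\<Sum>s\<in>S. \<Sum>u\<in>D s. r n ({Inl s} \<union> in_node S E head Og u) - r n (in_node S E head Og u))" for n
  define \<gamma> where "\<gamma> n = (\<Sum>s\<in>S. r n {Inl s}) - r n (Inl ` S)" for n
  have "(\<lambda>n. b n * \<delta> n) \<longlonglongrightarrow> (\<Sum>e\<in>E. 0) + (\<Sum>s\<in>S. \<Sum>u\<in>D s. 0)"
    unfolding \<delta>_def distrib_left sum_distrib_left
  proof (intro tendsto_add tendsto_sum approx_diff)
    show "h n ({Inr e} \<union> in_edge S E tail head Og e) - h n (in_edge S E tail head Og e) = 0" if "e \<in> E" for e n
      using h[of n] that by (simp add: C_T_def)
    show "h n ({Inl s} \<union> in_node S E head Og u) - h n (in_node S E head Og u) = 0" if "s \<in> S" "u \<in> D s" for s u n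
      using h[of n] that by (simp add: C_D_def)
  qed (use in_edge_subset[of S E tail head Og] in_node_subset[of S E head Og] in \<open>auto simp: links_def\<close>)
  then have \<delta>: "(\<lambda>n. b n * \<delta> n) \<longlonglongrightarrow> 0" by simp
  have \<gamma>: "(\<lambda>n. b n * \<gamma> n) \<longlonglongrightarrow> 0"
  proof -
    have "(\<lambda>n. (\<Sum>s\<in>S. b n * r n {Inl s} - c n * h n {Inl s}) - (b n * r n (Inl ` S) - c n * h n (Inl ` S)))
        \<longlonglongrightarrow> (\<Sum>s\<in>S. 0) - 0"
      by (intro tendsto_diff tendsto_sum approx) (auto simp: links_def)
    moreover have "(\<Sum>s\<in>S. b n * r n {Inl s} - c n * h n {Inl s}) - (b n * r n (Inl ` S) - c n * h n (Inl ` S))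
        = b n * \<gamma> n" for n
    proof -
      have "h n (Inl ` S) = (\<Sum>s\<in>S. h n {Inl s})"
        using h[of n] by (simp add: C_I_def)
      then show ?thesis
        by (simp add: \<gamma>_def sum_subtractf sum_distrib_left algebra_simps)
    qed
    ultimately show ?thesis by simp
  qed
  \<comment> \<open>The bound of \<open>exists_repaired_code\<close> on the source dimension lost by
    the repair.\<close>
  define \<eta> where "\<eta> n = \<delta> n + real (card S) * (\<delta> n + \<gamma> n)" for n
  have \<eta>: "(\<lambda>n. b n * \<eta> n) \<longlonglongrightarrow> 0"
  proof -
    have "(\<lambda>n. b n * \<delta> n + real (card S) * (b n * \<delta> n + b n * \<gamma> n)) \<longlonglongrightarrow> 0 + real (card S) * (0 + 0)"
      by (intro tendsto_intros \<delta> \<gamma>)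
    moreover have "b n * \<delta> n + real (card S) * (b n * \<delta> n + b n * \<gamma> n) = b n * \<eta> n" for n
      unfolding \<eta>_def by algebra
    ultimately show ?thesis by simp
  qed
  \<comment> \<open>All guarantees are bundled, so that one choice over \<open>n\<close> produces
    the sequence of codes.\<close>
  define good where "good n d Y \<longleftrightarrow> linear_code S E tail head Og d Y \<and>
    (\<forall>s\<in>S. \<forall>u\<in>D s. cond_entropy_zero S d Y (Inl s) (in_node S E head Og u)) \<and>
    (\<forall>s\<in>S. supp_size S d Y (Inl s) = CARD('k) ^ d (Inl s) \<and>
      real (d (Inl s)) \<le> r n {Inl s} \<and> r n {Inl s} \<le> real (d (Inl s)) + \<eta> n) \<and>
    (\<forall>e\<in>E. real (supp_size S d Y (Inr e)) \<le> ?q powr r n {Inr e})"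
    for n d and Y :: "'s + 'e \<Rightarrow> ('s \<Rightarrow> nat \<Rightarrow> 'k) \<Rightarrow> (nat \<Rightarrow> 'k)"
  have "\<forall>n. \<exists>p. good n (fst p) (snd p)"
  proof
    fix n
    show "\<exists>p. good n (fst p) (snd p)"
    proof (rule exists_repaired_code[OF finS finE finD U[of _ n] r_def \<delta>_def \<gamma>_def])
      fix d and Y :: "'s + 'e \<Rightarrow> ('s \<Rightarrow> nat \<Rightarrow> 'k) \<Rightarrow> (nat \<Rightarrow> 'k)"
      assume "linear_code S E tail head Og d Y"
        "\<And>s u. s \<in> S \<Longrightarrow> u \<in> D s \<Longrightarrow> cond_entropy_zero S d Y (Inl s) (in_node S E head Og u)"
        "\<And>s. s \<in> S \<Longrightarrow> supp_size S d Y (Inl s) = CARD('k) ^ d (Inl s)"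
        "\<And>s. s \<in> S \<Longrightarrow> real (d (Inl s)) \<le> r n {Inl s} \<and>
          r n {Inl s} \<le> real (d (Inl s)) + (\<delta> n + real (card S) * (\<delta> n + \<gamma> n))"
        "\<And>e. e \<in> E \<Longrightarrow> real (supp_size S d Y (Inr e)) \<le> ?q powr r n {Inr e}"
      then have "good n d Y"
        by (simp add: good_def \<eta>_def)
      then show ?thesis by (intro exI[of _ "(d, Y)"]) simp
    qed
  qed
  from choice[OF this] obtain dY where dY: "\<forall>n. good n (fst (dY n)) (snd (dY n))" ..
  define d Y where "d n = fst (dY n)" and "Y n = snd (dY n)" for n
  have good: "good n (d n) (Y n)" for n
    using dY by (simp add: d_def Y_def)
  \<comment> \<open>Dividing by \<open>ln ?q\<close> turns natural logarithms of support sizes into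
    logarithms to base \<open>q\<close>, which compare with dimensions.\<close>
  define w where "w n = b n / ln ?q" for n
  have w: "w n > 0" for n
    using b lnq by (simp add: w_def)
  define a where "a f n = w n * ln (real (supp_size S (d n) (Y n) f))" for f n
  have src: "\<exists>L. a (Inl s) \<longlonglongrightarrow> L \<and> L \<ge> lam s" if s: "s \<in> S" for s
  proof -
    obtain L where L: "(\<lambda>n. c n * fst (t n) s) \<longlonglongrightarrow> L" "L \<ge> lam s"
      using lamt[OF s] by blast
    have br: "(\<lambda>n. b n * r n {Inl s}) \<longlonglongrightarrow> L"
    proof -
      have "(\<lambda>n. (b n * r n {Inl s} - c n * h n {Inl s}) + c n * h n {Inl s}) \<longlonglongrightarrow> 0 + L"
        using L(1) s by (intro tendsto_add approx) (auto simp: th proj_def links_def)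
      then show ?thesis by simp
    qed
    have a: "a (Inl s) n = b n * real (d n (Inl s))" for n
      using good[of n] s lnq card by (simp add: a_def w_def good_def ln_realpow)
    \<comment> \<open>The source length lies between \<open>r n {Inl s} - \<eta> n\<close> and
      \<open>r n {Inl s}\<close>, and both bounds have the scaled limit \<open>L\<close>.\<close>
    have "a (Inl s) \<longlonglongrightarrow> L"
    proof (rule tendsto_sandwich)
      show "(\<lambda>n. b n * r n {Inl s} - b n * \<eta> n) \<longlonglongrightarrow> L"
        using tendsto_diff[OF br \<eta>] by simp
      show "\<forall>\<^sub>F n in sequentially. b n * r n {Inl s} - b n * \<eta> n \<le> a (Inl s) n"
      proof (intro always_eventually allI)
        fix n
        have "r n {Inl s} - \<eta> n \<le> real (d n (Inl s))"
          using good[of n] s by (fastforce simp: good_def)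
        then have "b n * (r n {Inl s} - \<eta> n) \<le> b n * real (d n (Inl s))"
          using b[of n] by (intro mult_left_mono) auto
        then show "b n * r n {Inl s} - b n * \<eta> n \<le> a (Inl s) n"
          by (simp add: a right_diff_distrib)
      qed
      show "\<forall>\<^sub>F n in sequentially. a (Inl s) n \<le> b n * r n {Inl s}"
        using good b s by (intro always_eventually allI) (simp add: a good_def)
    qed (fact br)
    with L(2) show ?thesis by blast
  qed
  have upper: "a (Inr e) n \<le> b n * r n {Inr e}" and nonneg: "a (Inr e) n \<ge> 0" if "e \<in> E" for e n
  proof -
    let ?z = "real (supp_size S (d n) (Y n) (Inr e))"
    \<comment> \<open>The convention \<open>ln 0 = 0\<close> settles a zero size directly; otherwise
      the size is at least 1 and its logarithm is nonnegative.\<close>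
    have ln: "0 \<le> ln ?z \<and> ln ?z \<le> r n {Inr e} * ln ?q"
    proof (cases "supp_size S (d n) (Y n) (Inr e) = 0")
      case True
      then show ?thesis using lnq by (simp add: r_def)
    next
      case False
      then have "ln ?z \<le> ln (?q powr r n {Inr e})"
        using good[of n] that by (intro ln_mono) (auto simp: good_def)
      then show ?thesis
        using False card by (simp add: ln_powr)
    qed
    then show "a (Inr e) n \<ge> 0"
      using w[of n] by (simp add: a_def)
    have "a (Inr e) n \<le> w n * (r n {Inr e} * ln ?q)"
      unfolding a_def using ln w[of n] by (intro mult_left_mono) auto
    then show "a (Inr e) n \<le> b n * r n {Inr e}"
      using lnq by (simp add: w_def)
  qed
  have edge: "\<exists>L. (\<lambda>n. b n * r n {Inr e}) \<longlonglongrightarrow> L \<and> L \<le> om e" if e: "e \<in> E" for e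
  proof -
    obtain L where L: "(\<lambda>n. c n * snd (t n) e) \<longlonglongrightarrow> L" "L \<le> om e"
      using omt[OF e] by blast
    have "(\<lambda>n. (b n * r n {Inr e} - c n * h n {Inr e}) + c n * h n {Inr e}) \<longlonglongrightarrow> 0 + L"
      using L(1) e by (intro tendsto_add approx) (auto simp: th proj_def links_def)
    with L(2) show ?thesis by auto
  qed
  \<comment> \<open>The repaired code bounds the edge supports only from above, so their normalised logarithms
    may oscillate; a subsequence restores the limits.\<close>
  have "Bseq (a (Inr e))" if e: "e \<in> E" for e
  proof -
    obtain L where "(\<lambda>n. b n * r n {Inr e}) \<longlonglongrightarrow> L"
      using edge[OF e] by blast
    then have "Bseq (\<lambda>n. b n * r n {Inr e})"
      by (intro convergent_imp_Bseq convergentI)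
    then obtain M where M: "\<forall>n. norm (b n * r n {Inr e}) \<le> M"
      unfolding Bseq_def by blast
    have "norm (a (Inr e) n) \<le> M" for n
      using upper[OF e, of n] nonneg[OF e, of n] spec[OF M, of n] by simp
    then show ?thesis by (rule BseqI')
  qed
  then obtain \<sigma> :: "nat \<Rightarrow> nat" where \<sigma>: "strict_mono \<sigma>" "\<And>e. e \<in> E \<Longrightarrow> convergent (a (Inr e) \<circ> \<sigma>)"
    using exists_common_convergent_subseq[OF finE, of "\<lambda>e. a (Inr e)"] by auto
  have src': "\<exists>L. (\<lambda>n. a (Inl s) (\<sigma> n)) \<longlonglongrightarrow> L \<and> L \<ge> lam s" if "s \<in> S" for s
    using src[OF that] LIMSEQ_subseq_LIMSEQ[OF _ \<sigma>(1)] by (auto simp: o_def)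
  have edge': "\<exists>L. (\<lambda>n. a (Inr e) (\<sigma> n)) \<longlonglongrightarrow> L \<and> L \<le> om e" if e: "e \<in> E" for e
  proof -
    obtain L where L: "(\<lambda>n. b n * r n {Inr e}) \<longlonglongrightarrow> L" "L \<le> om e"
      using edge[OF e] by blast
    obtain L' where L': "(\<lambda>n. a (Inr e) (\<sigma> n)) \<longlonglongrightarrow> L'"
      using \<sigma>(2)[OF e] by (auto simp: convergent_def o_def)
    have "(\<lambda>n. b (\<sigma> n) * r (\<sigma> n) {Inr e}) \<longlonglongrightarrow> L"
      using LIMSEQ_subseq_LIMSEQ[OF L(1) \<sigma>(1)] by (simp add: o_def)
    then have "L' \<le> L"
      using L' upper[OF e] by (intro LIMSEQ_le) auto
    with L(2) L' show ?thesis by force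
  qed
  show ?thesis
    unfolding zero_achievable_lin_def
  proof (intro exI[of _ "\<lambda>n. d (\<sigma> n)"] exI[of _ "\<lambda>n. Y (\<sigma> n)"] exI[of _ "\<lambda>n. w (\<sigma> n)"] conjI)
    show "\<forall>n. linear_code S E tail head Og (d (\<sigma> n)) (Y (\<sigma> n))"
      "\<forall>n. \<forall>s\<in>S. \<forall>u\<in>D s. cond_entropy_zero S (d (\<sigma> n)) (Y (\<sigma> n)) (Inl s) (in_node S E head Og u)"
      using good by (simp_all add: good_def)
    show "\<forall>n. w (\<sigma> n) > 0" using w by simp
  qed (use src' edge' in \<open>simp_all add: a_def\<close>)
qed

section \<open>From codes to representable functions\<close>

definition unit_vec :: "nat \<Rightarrow> nat \<Rightarrow> 'k::field" where
  "unit_vec k = (\<lambda>j. if j = k then 1 else 0)"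

lemma sum_fun_apply: "(\<Sum>a\<in>A. f a) x = (\<Sum>a\<in>A. f a x)"
  by (induction A rule: infinite_finite_induct) auto

lemma unit_vec_in_vecs: "k < m \<Longrightarrow> unit_vec k \<in> vecs m"
  by (auto simp: unit_vec_def vecs_def)

lemma inj_unit_vec: "inj (unit_vec :: nat \<Rightarrow> nat \<Rightarrow> 'k::field)"
proof (rule injI)
  fix k l assume "unit_vec k = (unit_vec l :: nat \<Rightarrow> 'k)"
  then have "unit_vec k k = (unit_vec l k :: 'k)" by simp
  then show "k = l" by (simp add: unit_vec_def split: if_splits)
qed

lemma vecs_eq_sum_unit_vec:
  assumes "w \<in> vecs m"
  shows "w = (\<Sum>k<m. fscale (w k) (unit_vec k))"
proof
  fix j
  have "(\<Sum>k<m. fscale (w k) (unit_vec k)) j = (\<Sum>k<m. if k = j then w k else 0)"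
    unfolding sum_fun_apply by (rule sum.cong) (auto simp: fscale_def unit_vec_def)
  also have "\<dots> = w j"
    using assms by (auto simp: vecs_def)
  finally show "w j = (\<Sum>k<m. fscale (w k) (unit_vec k)) j" ..
qed

lemma independent_unit_vec:
  assumes "finite I"
  shows "fvs.independent (unit_vec ` I :: (nat \<Rightarrow> 'k::field) set)"
proof (rule fvs.independent_if_scalars_zero)
  fix f :: "(nat \<Rightarrow> 'k) \<Rightarrow> 'k" and x :: "nat \<Rightarrow> 'k"
  assume f: "(\<Sum>x\<in>unit_vec ` I. fscale (f x) x) = 0" and x: "x \<in> unit_vec ` I"
  then obtain k where k: "k \<in> I" "x = unit_vec k" by blast
  have "(\<Sum>x\<in>unit_vec ` I. fscale (f x) x) k = (\<Sum>l\<in>I. if l = k then f (unit_vec l) else 0)"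
    unfolding sum_fun_apply sum.reindex[OF inj_on_subset[OF inj_unit_vec subset_UNIV]]
    by (rule sum.cong) (auto simp: fscale_def unit_vec_def)
  also have "\<dots> = f x"
    using assms k by simp
  finally show "f x = 0"
    unfolding f by simp
qed (simp add: assms)

lemma subspace_vecs: "fvs.subspace (vecs m)"
  by (auto simp: fvs.subspace_def vecs_def fscale_def)

text \<open>Numbering all source coordinates \<open>(s, i)\<close> by \<open>k s i\<close>
  identifies the outcomes with the dual of \<open>vecs m\<close>, \<open>\<phi>\<close> being the
  standard pairing. The last clause is the surjectivity of this identification: every functional is
  realised on \<open>vecs m\<close> by an outcome.\<close>

lemma exists_sample_space_pairing:
  fixes d :: "'s + 'e \<Rightarrow> nat"
  assumes "finite S"
  obtains m and \<phi> :: "('s \<Rightarrow> nat \<Rightarrow> 'k::field) \<Rightarrow> (nat \<Rightarrow> 'k) \<Rightarrow> 'k" and k :: "'s \<Rightarrow> nat \<Rightarrow> nat"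
  where "\<And>x. linear_functional (\<phi> x)" "\<And>w. \<phi> (\<lambda>_ _. 0) w = 0"
    "\<And>s i. s \<in> S \<Longrightarrow> i < d (Inl s) \<Longrightarrow> k s i < m"
    "inj_on (\<lambda>(s, i). k s i) (SIGMA s:S. {..<d (Inl s)})"
    "\<And>x s i. s \<in> S \<Longrightarrow> i < d (Inl s) \<Longrightarrow> \<phi> x (unit_vec (k s i)) = x s i"
    "\<And>\<psi>. linear_functional \<psi> \<Longrightarrow> \<exists>x\<in>sample_space S d. \<forall>w\<in>vecs m. \<phi> x w = \<psi> w"
proof -
  let ?I = "SIGMA s:S. {..<d (Inl s)}"
  have finI: "finite ?I" using assms by simp
  obtain h where h: "bij_betw h ?I {0..<card ?I}"
    using ex_bij_betw_finite_nat[OF finI] by blast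
  define m where "m = card ?I"
  define k where "k s i = h (s, i)" for s i
  define \<phi> where "\<phi> x w = (\<Sum>(s, i)\<in>?I. x s i * w (k s i))" for x :: "'s \<Rightarrow> nat \<Rightarrow> 'k" and w
  have h': "bij_betw (\<lambda>(s, i). k s i) ?I {..<m}"
    using h by (simp add: k_def m_def atLeast0LessThan case_prod_beta')
  have lin: "linear_functional (\<phi> x)" for x
    unfolding Vector_Spaces.linear_iff
  proof (intro conjI allI)
    fix y z :: "nat \<Rightarrow> 'k" and c
    show "\<phi> x (y + z) = \<phi> x y + \<phi> x z"
      by (simp add: \<phi>_def case_prod_beta' distrib_left sum.distrib)
    show "\<phi> x (fscale c y) = c * \<phi> x y"
      unfolding \<phi>_def sum_distrib_left by (rule sum.cong) (auto simp: fscale_def)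
  qed (fact fvs.vector_space_axioms functional.vs2.vector_space_axioms)+
  have zero: "\<phi> (\<lambda>_ _. 0) w = 0" for w
    by (simp add: \<phi>_def)
  have km: "k s i < m" if "s \<in> S" "i < d (Inl s)" for s i
    using bij_betwE[OF h'] that by force
  have inj: "inj_on (\<lambda>(s, i). k s i) ?I"
    using h' by (rule bij_betw_imp_inj_on)
  have unit: "\<phi> x (unit_vec (k s i)) = x s i" if si: "s \<in> S" "i < d (Inl s)" for x s i
  proof -
    have "\<phi> x (unit_vec (k s i)) = (\<Sum>p\<in>?I. if p = (s, i) then x s i else 0)"
      unfolding \<phi>_def
    proof (rule sum.cong[OF refl])
      fix p assume p: "p \<in> ?I"
      obtain s' i' where [simp]: "p = (s', i')" by fastforce
      have "k s' i' = k s i \<longleftrightarrow> p = (s, i)"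
        using inj_on_eq_iff[OF inj p, of "(s, i)"] si by auto
      then show "(case p of (s', i') \<Rightarrow> x s' i' * unit_vec (k s i) (k s' i')) = (if p = (s, i) then x s i else 0)"
        by (auto simp: unit_vec_def)
    qed
    also have "\<dots> = x s i"
      using finI si by simp
    finally show ?thesis .
  qed
  have dual: "\<exists>x\<in>sample_space S d. \<forall>w\<in>vecs m. \<phi> x w = \<psi> w" if \<psi>: "linear_functional \<psi>" for \<psi>
  proof -
    \<comment> \<open>The coordinates of \<open>\<psi>\<close> in the dual basis; the default 0 puts
      \<open>x\<close> into the sample space.\<close>
    define x where "x s i = (if s \<in> S \<and> i < d (Inl s) then \<psi> (unit_vec (k s i)) else 0)" for s i
    have "\<phi> x w = \<psi> w" if w: "w \<in> vecs m" for w
    proof -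
      have "\<psi> w = \<psi> (\<Sum>l<m. fscale (w l) (unit_vec l))"
        using vecs_eq_sum_unit_vec[OF w] by simp
      also have "\<dots> = (\<Sum>l<m. w l * \<psi> (unit_vec l))"
        by (simp add: functional.linear_sum[OF \<psi>] functional.linear_scale[OF \<psi>])
      also have "\<dots> = (\<Sum>p\<in>?I. w ((\<lambda>(s, i). k s i) p) * \<psi> (unit_vec ((\<lambda>(s, i). k s i) p)))"
        by (rule sum.reindex_bij_betw[OF h', symmetric])
      also have "\<dots> = \<phi> x w"
        unfolding \<phi>_def by (rule sum.cong) (auto simp: x_def)
      finally show ?thesis by simp
    qed
    moreover have "x \<in> sample_space S d"
      by (auto simp: x_def sample_space_def vecs_def)
    ultimately show ?thesis by blast
  qed
  show ?thesis
    by (rule that[OF lin zero km inj unit dual])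
qed

section \<open>Acyclicity as a recursion principle, and the subspaces of a code\<close>

text \<open>A cycle of the relation unrolls into a list of links excluded by
  \<open>acyclic_net\<close>, and a finite acyclic relation is well-founded. This allows induction
  on an edge via the edges entering it.\<close>

lemma acyclic_net_imp_wf:
  assumes "finite E" "acyclic_net E tail head"
  shows "wf {(f, e). f \<in> E \<and> e \<in> E \<and> tail e \<in> head f}" (is "wf ?R")
proof (rule finite_acyclic_wf)
  show "finite ?R"
    by (rule finite_subset[of _ "E \<times> E"]) (use assms(1) in auto)
  \<comment> \<open>The list starts at \<open>x\<close> and stops just before \<open>y\<close>, so
    for \<open>y = x\<close> the last condition is the closing condition of a directed
    cycle.\<close>
  have path: "\<exists>fs. fs \<noteq> [] \<and> set fs \<subseteq> E \<and> hd fs = x \<and>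
      (\<forall>i. Suc i < length fs \<longrightarrow> tail (fs ! Suc i) \<in> head (fs ! i)) \<and> tail y \<in> head (last fs)"
    if "(x, y) \<in> ?R\<^sup>+" for x y
    using that
  proof (induction rule: trancl_induct)
    case (base y)
    then show ?case by (intro exI[of _ "[x]"]) auto
  next
    case (step y z)
    then obtain fs where fs: "fs \<noteq> []" "set fs \<subseteq> E" "hd fs = x"
      "\<And>i. Suc i < length fs \<Longrightarrow> tail (fs ! Suc i) \<in> head (fs ! i)" "tail y \<in> head (last fs)"
      by blast
    have "tail ((fs @ [y]) ! Suc i) \<in> head ((fs @ [y]) ! i)" if "Suc i < length (fs @ [y])" for i
    proof (cases "Suc i < length fs")
      case True
      then show ?thesis using fs(4)[of i] by (simp add: nth_append)
    next
      case False
      then have "Suc i = length fs" using that by simp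
      then show ?thesis
        using fs(1,5) by (auto simp: nth_append last_conv_nth dest: sym)
    qed
    then show ?case
      using fs step.hyps by (intro exI[of _ "fs @ [y]"]) auto
  qed
  show "acyclic ?R"
    unfolding acyclic_def
  proof (intro allI notI)
    fix x assume "(x, x) \<in> ?R\<^sup>+"
    from path[OF this] assms(2) show False
      unfolding acyclic_net_def by blast
  qed
qed

text \<open>The value \<open>Y x\<close> is determined by \<open>\<phi> x\<close> on a basis of the
  vectors \<open>u j\<close>, and by \<open>dual\<close> the values on that basis are arbitrary.
  Hence there are as many values as functions from the basis to the field.\<close>

lemma card_functional_values:
  fixes \<phi> :: "'x \<Rightarrow> (nat \<Rightarrow> 'k::{finite,field}) \<Rightarrow> 'k" and u :: "nat \<Rightarrow> nat \<Rightarrow> 'k"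
  assumes lin: "\<And>x. linear_functional (\<phi> x)"
    and dual: "\<And>\<psi>. linear_functional \<psi> \<Longrightarrow> \<exists>x\<in>X. \<forall>w\<in>vecs m. \<phi> x w = \<psi> w"
    and u: "\<And>j. j < n \<Longrightarrow> u j \<in> vecs m"
    and Y: "\<And>x j. x \<in> X \<Longrightarrow> Y x j = (if j < n then \<phi> x (u j) else 0)"
  shows "card (Y ` X) = CARD('k) ^ fvs.dim (u ` {..<n})"
proof -
  obtain B where B: "B \<subseteq> u ` {..<n}" "fvs.independent B" "u ` {..<n} \<subseteq> fvs.span B"
    "card B = fvs.dim (u ` {..<n})"
    by (rule fvs.basis_exists)
  have finB: "finite B" using B(1) by (rule finite_subset) simp
  \<comment> \<open>Several indices may carry the same vector; whichever is picked, the entry of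
    \<open>Y x\<close> there is \<open>\<phi> x b\<close>.\<close>
  define G where "G y = restrict (\<lambda>b. y (SOME j. j < n \<and> u j = b)) B" for y :: "nat \<Rightarrow> 'k"
  have G: "G (Y x) b = \<phi> x b" if "x \<in> X" "b \<in> B" for x b
  proof -
    have "\<exists>j. j < n \<and> u j = b" using B(1) that(2) by blast
    from someI_ex[OF this] show ?thesis
      using that by (simp add: G_def Y)
  qed
  have "bij_betw G (Y ` X) (B \<rightarrow>\<^sub>E UNIV)"
    unfolding bij_betw_def
  proof
    show "inj_on G (Y ` X)"
    proof (rule inj_onI, clarify)
      fix x x' assume x: "x \<in> X" "x' \<in> X" "G (Y x) = G (Y x')"
      have "\<phi> x w = \<phi> x' w" if "w \<in> fvs.span B" for w
      proof (rule functional.linear_eq_on[OF lin lin that])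
        fix b assume "b \<in> B"
        then show "\<phi> x b = \<phi> x' b" using G x by metis
      qed
      then show "Y x = Y x'"
        using B(3) x(1,2) by (intro ext) (auto simp: Y)
    qed
    show "G ` Y ` X = B \<rightarrow>\<^sub>E UNIV"
    proof
      show "G ` Y ` X \<subseteq> B \<rightarrow>\<^sub>E UNIV" by (auto simp: G_def)
      show "B \<rightarrow>\<^sub>E UNIV \<subseteq> G ` Y ` X"
      proof
        fix y :: "(nat \<Rightarrow> 'k) \<Rightarrow> 'k" assume y: "y \<in> B \<rightarrow>\<^sub>E UNIV"
        obtain \<psi> where \<psi>: "linear_functional \<psi>" "\<forall>b\<in>B. \<psi> b = y b"
          using functional.linear_independent_extend[OF B(2)] by blast
        obtain x where x: "x \<in> X" "\<forall>w\<in>vecs m. \<phi> x w = \<psi> w"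
          using dual[OF \<psi>(1)] by blast
        have "G (Y x) = y"
        proof (rule extensionalityI[of _ B])
          show "y \<in> extensional B" using y by (simp add: PiE_def)
          fix b assume b: "b \<in> B"
          then have "b \<in> vecs m" using B(1) u by blast
          then show "G (Y x) b = y b" using G[OF x(1) b] x(2) \<psi>(2) b by simp
        qed (simp add: G_def)
        then show "y \<in> G ` Y ` X" using x(1) by blast
      qed
    qed
  qed
  then have "card (Y ` X) = card (B \<rightarrow>\<^sub>E (UNIV :: 'k set))"
    by (rule bij_betw_same_card)
  then show ?thesis
    using finB B(4) by (simp add: card_funcsetE)
qed

text \<open>Each entry of \<open>Y f\<close> is a linear form in the outcome, that is, a vector of
  \<open>vecs m\<close> under the pairing. The spans of these vectors are the subspaces, and
  \<open>h\<close> is their dimension function; no approximation enters.\<close>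

lemma linear_code_representation:
  fixes Y :: "'s + 'e \<Rightarrow> ('s \<Rightarrow> nat \<Rightarrow> 'k::{finite,field}) \<Rightarrow> (nat \<Rightarrow> 'k)"
  assumes finS: "finite S" and finE: "finite E" and acyclic: "acyclic_net E tail head"
    and code: "linear_code S E tail head Og d Y"
    and decode: "\<And>s u. s \<in> S \<Longrightarrow> u \<in> D s \<Longrightarrow> cond_entropy_zero S d Y (Inl s) (in_node S E head Og u)"
  obtains h where "q_representable TYPE('k) (links S E) h"
    "h \<in> C_I S" "h \<in> C_T S E tail head Og" "h \<in> C_D S E head Og D"
    "\<And>f. f \<in> links S E \<Longrightarrow> ln (real (supp_size S d Y f)) = h {f} * ln (real CARD('k))"
proof -
  let ?N = "links S E" and ?X = "sample_space S d :: ('s \<Rightarrow> nat \<Rightarrow> 'k) set"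
  show ?thesis
  proof (rule exists_sample_space_pairing[OF finS, of d])
    fix m and \<phi> :: "('s \<Rightarrow> nat \<Rightarrow> 'k) \<Rightarrow> (nat \<Rightarrow> 'k) \<Rightarrow> 'k" and k :: "'s \<Rightarrow> nat \<Rightarrow> nat"
    assume lin: "\<And>x. linear_functional (\<phi> x)"
      and \<phi>0: "\<And>w. \<phi> (\<lambda>_ _. 0) w = 0"
      and km: "\<And>s i. s \<in> S \<Longrightarrow> i < d (Inl s) \<Longrightarrow> k s i < m"
      and inj: "inj_on (\<lambda>(s, i). k s i) (SIGMA s:S. {..<d (Inl s)})"
      and unit: "\<And>x s i. s \<in> S \<Longrightarrow> i < d (Inl s) \<Longrightarrow> \<phi> x (unit_vec (k s i)) = x s i"
      and dual: "\<And>\<psi>. linear_functional \<psi> \<Longrightarrow> \<exists>x\<in>?X. \<forall>w\<in>vecs m. \<phi> x w = \<psi> w"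
    \<comment> \<open>The vector \<open>v j\<close> represents the \<open>j\<close>-th entry of
      \<open>Y f\<close> as a linear form.\<close>
    define rep where "rep f v \<longleftrightarrow> (\<forall>j<d f. v j \<in> vecs m) \<and>
      (\<forall>x\<in>?X. \<forall>j. Y f x j = (if j < d f then \<phi> x (v j) else 0))" for f v
    have rep_src: "rep (Inl s) (\<lambda>j. unit_vec (k s j))" if "s \<in> S" for s
    proof -
      have "Y (Inl s) x = x s" "x s \<in> vecs (d (Inl s))" if "x \<in> ?X" for x
        using code \<open>s \<in> S\<close> that sample_space_vecs[OF that \<open>s \<in> S\<close>]
        unfolding linear_code_def by blast+
      moreover have "unit_vec (k s j) \<in> vecs m" if "j < d (Inl s)" for j
        using km[OF \<open>s \<in> S\<close> that] by (rule unit_vec_in_vecs)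
      ultimately show ?thesis
        using unit[OF that] unfolding rep_def by (auto simp: vecs_def[of "d (Inl s)"])
    qed
    have rep_edge: "\<exists>v. rep (Inr e) v" if "e \<in> E" for e
      using acyclic_net_imp_wf[OF finE acyclic] that
    proof (induction e rule: wf_induct_rule)
      case (less e)
      let ?I = "in_edge S E tail head Og e"
      have "\<exists>v. rep f v" if "f \<in> ?I" for f
      proof (cases f)
        case (Inl s)
        then show ?thesis using rep_src that by (auto simp: in_edge_def links_def)
      next
        case (Inr e')
        then show ?thesis
          using that less by (auto simp: in_edge_def links_def link_head_def)
      qed
      then obtain v where v: "\<And>f. f \<in> ?I \<Longrightarrow> rep f (v f)"
        by metis
      obtain c where c: "\<forall>x\<in>?X. Y (Inr e) x =
          (\<lambda>j. if j < d (Inr e) then (\<Sum>f\<in>?I. \<Sum>i<d f. c f i j * Y f x i) else 0)"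
        using code less.prems unfolding linear_code_def by blast
      \<comment> \<open>The encoding coefficients of the entries are applied to their representing
        vectors; linearity of \<open>\<phi> x\<close> gives the same combination of values.\<close>
      have "rep (Inr e) (\<lambda>j. \<Sum>f\<in>?I. \<Sum>i<d f. fscale (c f i j) (v f i))"
        unfolding rep_def
      proof (intro conjI allI impI ballI)
        fix j
        show "(\<Sum>f\<in>?I. \<Sum>i<d f. fscale (c f i j) (v f i)) \<in> vecs m"
          using v by (intro fvs.subspace_sum fvs.subspace_scale subspace_vecs) (auto simp: rep_def)
      next
        fix x j assume x: "x \<in> ?X"
        have "(\<Sum>f\<in>?I. \<Sum>i<d f. c f i j * Y f x i) = (\<Sum>f\<in>?I. \<Sum>i<d f. c f i j * \<phi> x (v f i))"
          using v x by (intro sum.cong) (auto simp: rep_def)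
        also have "\<dots> = \<phi> x (\<Sum>f\<in>?I. \<Sum>i<d f. fscale (c f i j) (v f i))"
          by (simp add: functional.linear_sum[OF lin] functional.linear_scale[OF lin])
        finally show "Y (Inr e) x j = (if j < d (Inr e)
            then \<phi> x (\<Sum>f\<in>?I. \<Sum>i<d f. fscale (c f i j) (v f i)) else 0)"
          using bspec[OF c x] by simp
      qed
      then show ?case by blast
    qed
    define v where "v f = (case f of Inl s \<Rightarrow> (\<lambda>j. unit_vec (k s j)) | Inr e \<Rightarrow> (SOME v. rep (Inr e) v))" for f
    have rep: "rep f (v f)" if "f \<in> ?N" for f
      using that rep_src someI_ex[OF rep_edge] by (auto simp: links_def v_def)
    define B where "B f = v f ` {..<d f}" for f
    define U where "U f = fvs.span (B f)" for f
    define h where "h \<alpha> = real (fvs.dim (\<Union>f\<in>\<alpha>. U f))" for \<alpha>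
    have BU: "fvs.span (\<Union>f\<in>A. U f) = fvs.span (\<Union>f\<in>A. B f)" for A
    proof -
      have "U f \<subseteq> fvs.span (\<Union>f\<in>A. B f)" if "f \<in> A" for f
        unfolding U_def using that by (intro fvs.span_mono) auto
      moreover have "B f \<subseteq> fvs.span (\<Union>f\<in>A. U f)" if "f \<in> A" for f
        using fvs.span_superset[of "B f"] fvs.span_superset[of "\<Union>f\<in>A. U f"] that unfolding U_def by blast
      ultimately show ?thesis
        unfolding fvs.span_eq by blast
    qed
    have hB: "h A = real (fvs.dim (\<Union>f\<in>A. B f))" for A
      unfolding h_def using fvs.span_eq_dim[OF BU] by simp
    have Bvecs: "B f \<subseteq> vecs m" if "f \<in> ?N" for f
      using rep[OF that] by (auto simp: B_def rep_def)
    \<comment> \<open>By linearity, determination of \<open>Y g\<close> need only be tested at zero.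
      If some \<open>v g j\<close> were outside the span of the vectors of \<open>A\<close>, a
      functional vanishing on that span but equal to 1 at \<open>v g j\<close> would come from an
      outcome where all \<open>Y f\<close> with \<open>f \<in> A\<close> are zero and
      \<open>Y g\<close> is not.\<close>
    have absorb: "h ({g} \<union> A) - h A = 0" if g: "g \<in> ?N" and A: "A \<subseteq> ?N"
      and det: "\<And>x. x \<in> ?X \<Longrightarrow> \<forall>f\<in>A. Y f x = (\<lambda>_. 0) \<Longrightarrow> Y g x = (\<lambda>_. 0)" for g A
    proof -
      have "B g \<subseteq> fvs.span (\<Union>f\<in>A. B f)"
      proof (rule ccontr)
        assume "\<not> ?thesis"
        then obtain j where j: "j < d g" "v g j \<notin> fvs.span (\<Union>f\<in>A. B f)"
          by (auto simp: B_def)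
        obtain C where C: "C \<subseteq> (\<Union>f\<in>A. B f)" "fvs.independent C" "(\<Union>f\<in>A. B f) \<subseteq> fvs.span C"
          by (rule fvs.maximal_independent_subset)
        have vC: "v g j \<notin> fvs.span C"
          using j(2) fvs.span_mono[OF C(1)] by blast
        then have "fvs.independent (insert (v g j) C)"
          using C(2) by (rule fvs.independent_insertI)
        then obtain \<psi> where \<psi>: "linear_functional \<psi>"
          "\<forall>w\<in>insert (v g j) C. \<psi> w = (if w = v g j then 1 else 0)"
          using functional.linear_independent_extend[where f = "\<lambda>w. if w = v g j then 1 else 0"] by blast
        have vC': "v g j \<notin> C" using vC fvs.span_base by blast
        have \<psi>0: "\<psi> w = 0" if "w \<in> fvs.span C" for w
          using \<psi>(2) vC' by (intro functional.linear_eq_0_on_span[OF \<psi>(1) _ that]) auto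
        obtain x where x: "x \<in> ?X" "\<forall>w\<in>vecs m. \<phi> x w = \<psi> w"
          using dual[OF \<psi>(1)] by blast
        have "Y f x = (\<lambda>_. 0)" if f: "f \<in> A" for f
        proof
          fix i
          have "\<phi> x (v f i) = 0" if "i < d f"
          proof -
            have "v f i \<in> B f" using that by (simp add: B_def)
            then have "v f i \<in> vecs m" "v f i \<in> fvs.span C"
              using Bvecs[of f] A f C(3) by blast+
            then show ?thesis using x(2) \<psi>0 by simp
          qed
          then show "Y f x i = 0"
            using rep[of f] A f x(1) by (auto simp: rep_def)
        qed
        then have "Y g x j = 0" using det[OF x(1)] by simp
        then have "\<phi> x (v g j) = 0"
          using rep[OF g] x(1) j(1) by (auto simp: rep_def)
        moreover have "v g j \<in> vecs m"
          using rep[OF g] j(1) by (auto simp: rep_def)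
        ultimately show False
          using x(2) \<psi>(2) by simp
      qed
      then have "fvs.span (\<Union>f\<in>{g} \<union> A. B f) = fvs.span (\<Union>f\<in>A. B f)"
        unfolding fvs.span_eq using fvs.span_superset[of "\<Union>f\<in>A. B f"]
          fvs.span_superset[of "\<Union>f\<in>{g} \<union> A. B f"] by auto
      from fvs.span_eq_dim[OF this] show ?thesis
        unfolding hB by simp
    qed
    show ?thesis
    proof (rule that)
      show "q_representable TYPE('k) ?N h"
        unfolding q_representable_def
      proof (intro exI[of _ m] exI[of _ U] conjI ballI allI impI)
        fix f assume "f \<in> ?N"
        then show "U f \<subseteq> vecs m"
          unfolding U_def using Bvecs subspace_vecs by (intro fvs.span_minimal)
      qed (simp_all add: U_def h_def)
    next
      \<comment> \<open>Source vectors are distinct unit vectors, so the dimension of any set of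
        sources counts its coordinates. The general \<open>T\<close> covers both the singletons and
        \<open>S\<close> itself.\<close>
      have BI: "(\<Union>f\<in>Inl ` T. B f) = unit_vec ` (\<lambda>(s, i). k s i) ` (SIGMA s:T. {..<d (Inl s)})" for T
        by (force simp: B_def v_def image_iff)
      have dimT: "h (Inl ` T) = (\<Sum>s\<in>T. real (d (Inl s)))" if "T \<subseteq> S" for T
      proof -
        have finT: "finite T" using that finS finite_subset by blast
        have injT: "inj_on (\<lambda>(s, i). k s i) (SIGMA s:T. {..<d (Inl s)})"
          by (rule inj_on_subset[OF inj]) (use that in auto)
        have "fvs.dim (\<Union>f\<in>Inl ` T. B f) = card (\<Union>f\<in>Inl ` T. B f)"
          unfolding BI using finT by (intro fvs.dim_eq_card_independent independent_unit_vec) auto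
        also have "\<dots> = card (SIGMA s:T. {..<d (Inl s)})"
          unfolding BI by (simp add: card_image injT inj_on_subset[OF inj_unit_vec])
        also have "\<dots> = (\<Sum>s\<in>T. d (Inl s))"
          using finT by simp
        finally show ?thesis unfolding hB by simp
      qed
      have "h {Inl s} = real (d (Inl s))" if "s \<in> S" for s
        using dimT[of "{s}"] that by simp
      then show "h \<in> C_I S"
        using dimT[of S] by (simp add: C_I_def)
    next
      show "h \<in> C_T S E tail head Og"
        unfolding C_T_def
      proof (intro CollectI ballI)
        fix e assume e: "e \<in> E"
        show "h ({Inr e} \<union> in_edge S E tail head Og e) - h (in_edge S E tail head Og e) = 0"
        proof (rule absorb[OF _ in_edge_subset])
          show "Inr e \<in> ?N" using e by (simp add: links_def)
          fix x assume x: "x \<in> ?X" "\<forall>f\<in>in_edge S E tail head Og e. Y f x = (\<lambda>_. 0)"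
          obtain c where "Y (Inr e) x = (\<lambda>j. if j < d (Inr e)
              then (\<Sum>f\<in>in_edge S E tail head Og e. \<Sum>i<d f. c f i j * Y f x i) else 0)"
            using code e x(1) unfolding linear_code_def by blast
          then show "Y (Inr e) x = (\<lambda>_. 0)"
            using x(2) by (auto simp: fun_eq_iff)
        qed
      qed
    next
      show "h \<in> C_D S E head Og D"
        unfolding C_D_def
      proof (intro CollectI ballI)
        fix s u assume s: "s \<in> S" and u: "u \<in> D s"
        show "h ({Inl s} \<union> in_node S E head Og u) - h (in_node S E head Og u) = 0"
        proof (rule absorb[OF _ in_node_subset])
          show l: "Inl s \<in> ?N" using s by (simp add: links_def)
          \<comment> \<open>Decodability compares two outcomes; taking the zero outcome as the
            second turns it into the vanishing condition of \<open>absorb\<close>.\<close>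
          have zero: "(\<lambda>_ _. 0) \<in> ?X" by (simp add: sample_space_def vecs_def)
          have Y0: "Y f (\<lambda>_ _. 0) = (\<lambda>_. 0)" if "f \<in> ?N" for f
            using rep[OF that] zero \<phi>0 by (auto simp: rep_def fun_eq_iff)
          fix x assume x: "x \<in> ?X" "\<forall>f\<in>in_node S E head Og u. Y f x = (\<lambda>_. 0)"
          then have "\<forall>f\<in>in_node S E head Og u. Y f x = Y f (\<lambda>_ _. 0)"
            using Y0 in_node_subset[of S E head Og u] by auto
          then have "Y (Inl s) x = Y (Inl s) (\<lambda>_ _. 0)"
            using decode[OF s u] x(1) zero unfolding cond_entropy_zero_def by blast
          then show "Y (Inl s) x = (\<lambda>_. 0)" using Y0[OF l] by simp
        qed
      qed
    next
      fix f assume f: "f \<in> ?N"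
      have "supp_size S d Y f = CARD('k) ^ fvs.dim (v f ` {..<d f})"
        unfolding supp_size_def
        by (rule card_functional_values[OF lin dual]) (use rep[OF f] in \<open>auto simp: rep_def\<close>)
      moreover have "h {f} = real (fvs.dim (v f ` {..<d f}))"
        by (simp add: hB B_def)
      ultimately show "ln (real (supp_size S d Y f)) = h {f} * ln (real CARD('k))"
        by (simp add: ln_realpow)
    qed
  qed
qed

section \<open>From sequences of codes to the closure\<close>

lemma q_representable_imp_almost:
  assumes "q_representable TYPE('k::{finite,field}) N h"
  shows "almost_q_representable TYPE('k) N h"
proof -
  have "weakly_q_representable TYPE('k) N h"
    unfolding weakly_q_representable_def using assms by (intro exI[of _ 1]) simp
  then show ?thesis
    unfolding almost_q_representable_def by (intro exI[of _ "\<lambda>_. h"]) simp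
qed

text \<open>Every code of the sequence yields a function in the constrained set itself, so the
  limits carry over unchanged once the factor \<open>ln (real CARD('k))\<close> is absorbed into the
  scaling.\<close>

lemma zero_achievable_imp_CL:
  assumes finS: "finite S" and finE: "finite E" and acyclic: "acyclic_net E tail head"
    and ach: "zero_achievable_lin TYPE('k::{finite,field}) E tail head S Og D lam om"
  shows "(lam, om) \<in> CL S E (proj ` (Upsilon_bar TYPE('k) S E \<inter> C_I S
                                    \<inter> C_T S E tail head Og \<inter> C_D S E head Og D))"
proof -
  let ?R = "Upsilon_bar TYPE('k) S E \<inter> C_I S \<inter> C_T S E tail head Og \<inter> C_D S E head Og D"
  obtain d Y c where code: "\<forall>n. linear_code S E tail head Og (d n) (Y n :: _ \<Rightarrow> ('a \<Rightarrow> nat \<Rightarrow> 'k) \<Rightarrow> _)"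
    and c: "\<forall>n :: nat. c n > 0"
    and src: "\<forall>s\<in>S. \<exists>L. (\<lambda>n. c n * ln (real (supp_size S (d n) (Y n) (Inl s)))) \<longlonglongrightarrow> L \<and> L \<ge> lam s"
    and edge: "\<forall>e\<in>E. \<exists>L. (\<lambda>n. c n * ln (real (supp_size S (d n) (Y n) (Inr e)))) \<longlonglongrightarrow> L \<and> L \<le> om e"
    and decode: "\<forall>n. \<forall>s\<in>S. \<forall>u\<in>D s. cond_entropy_zero S (d n) (Y n) (Inl s) (in_node S E head Og u)"
    using ach unfolding zero_achievable_lin_def by (elim exE conjE)
  have "\<forall>n. \<exists>h. h \<in> ?R \<and>
      (\<forall>f\<in>links S E. ln (real (supp_size S (d n) (Y n) f)) = h {f} * ln (real CARD('k)))"
  proof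
    fix n
    show "\<exists>h. h \<in> ?R \<and>
      (\<forall>f\<in>links S E. ln (real (supp_size S (d n) (Y n) f)) = h {f} * ln (real CARD('k)))"
    proof (rule linear_code_representation[OF finS finE acyclic, of Og "d n" "Y n" D])
      fix h assume "q_representable TYPE('k) (links S E) h"
        "h \<in> C_I S" "h \<in> C_T S E tail head Og" "h \<in> C_D S E head Og D"
        "\<And>f. f \<in> links S E \<Longrightarrow> ln (real (supp_size S (d n) (Y n) f)) = h {f} * ln (real CARD('k))"
      then show ?thesis
        by (intro exI[of _ h]) (simp add: Upsilon_bar_def q_representable_imp_almost)
    qed (use code decode in auto)
  qed
  from choice[OF this] obtain h where h: "\<forall>n. h n \<in> ?R \<and>
      (\<forall>f\<in>links S E. ln (real (supp_size S (d n) (Y n) f)) = h n {f} * ln (real CARD('k)))" ..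
  define w where "w n = c n * ln (real CARD('k))" for n
  have eq: "c n * ln (real (supp_size S (d n) (Y n) f)) = w n * h n {f}" if "f \<in> links S E" for n f
    using h that by (simp add: w_def)
  have w: "w n > 0" for n
    using c card_field_gt_1[where 'k = 'k] by (simp add: w_def)
  have "\<exists>L. (\<lambda>n. w n * h n {Inl s}) \<longlonglongrightarrow> L \<and> L \<ge> lam s" if "s \<in> S" for s
    using bspec[OF src that] eq[of "Inl s"] that by (simp add: links_def)
  moreover have "\<exists>L. (\<lambda>n. w n * h n {Inr e}) \<longlonglongrightarrow> L \<and> L \<le> om e" if "e \<in> E" for e
    using bspec[OF edge that] eq[of "Inr e"] that by (simp add: links_def)
  moreover have "proj (h n) \<in> proj ` ?R" for n
    using h by blast
  ultimately show ?thesis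
    unfolding CL_def using w
    by (intro CollectI case_prodI exI[of _ "\<lambda>n. proj (h n)"] exI[of _ w]) (simp add: proj_def)
qed

theorem theorem4:
  fixes V :: "'v set" and E :: "'e set" and tail :: "'e \<Rightarrow> 'v" and head :: "'e \<Rightarrow> 'v set"
    and S :: "'s set" and Og :: "'s \<Rightarrow> 'v set" and D :: "'s \<Rightarrow> 'v set"
    and lam :: "'s \<Rightarrow> real" and om :: "'e \<Rightarrow> real"
  assumes "network_problem V E tail head S Og D"
    and "\<forall>s\<in>S. lam s \<ge> 0" and "\<forall>e\<in>E. om e \<ge> 0"
  shows "zero_achievable_lin TYPE('k::{finite,field}) E tail head S Og D lam om \<longleftrightarrow>
         (lam, om) \<in> CL S E (proj ` (Upsilon_bar TYPE('k) S E \<inter> C_I S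
                                    \<inter> C_T S E tail head Og \<inter> C_D S E head Og D))"
proof
  assume "zero_achievable_lin TYPE('k) E tail head S Og D lam om"
  then show "(lam, om) \<in> CL S E (proj ` (Upsilon_bar TYPE('k) S E \<inter> C_I S
      \<inter> C_T S E tail head Og \<inter> C_D S E head Og D))"
    using assms(1) by (intro zero_achievable_imp_CL) (simp_all add: network_problem_def)
next
  assume CL: "(lam, om) \<in> CL S E (proj ` (Upsilon_bar TYPE('k) S E \<inter> C_I S
      \<inter> C_T S E tail head Og \<inter> C_D S E head Og D))"
  \<comment> \<open>The repair sums over all pairs of a source and a sink, so the sink sets must be
    finite; they are subsets of \<open>V\<close>.\<close>
  have "finite (D s)" if "s \<in> S" for s
    using assms(1) that finite_subset[of "D s" V] by (simp add: network_problem_def)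
  then show "zero_achievable_lin TYPE('k) E tail head S Og D lam om"
    using assms(1) by (intro CL_imp_zero_achievable[OF _ _ _ CL]) (auto simp: network_problem_def)
qed

end
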